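(* Let $d,\gamma,p\in\mathbb N$ with $p>\gamma$ and let $\mathbf x_0\in\mathbb R^d$. Consider a linear differential operator of order at most $\gamma$, $\mathcal L=\sum_{m=0}^\gamma\sum_{|\mathbf j|=m}c_{\mathbf j}\,\partial_{\mathbf x}^{\mathbf j}$, with variable coefficients $c_{\mathbf j}\in\mathcal C^{p-\gamma}(\mathbf x_0)$ for $\mathbf j\in\mathbb N_0^d$, $|\mathbf j|\le\gamma$, and the corresponding constant-coefficient operator $\mathcal L_*=\sum_{|\mathbf j|=\gamma}c_{\mathbf j}(\mathbf x_0)\,\partial_{\mathbf x}^{\mathbf j}$, so that $\mathcal L_*:\widetilde{\mathbb P}_{n+\gamma}\to\widetilde{\mathbb P}_n$ for all $n\in\mathbb N_0$. Assume that for all $n\in\{\gamma,\dots,p\}$, $\widetilde{\mathbb P}_n=\mathbb U_n\oplus\mathbb V_n$ and $\mathcal L_*|_{\mathbb V_n}:\mathbb V_n\to\widetilde{\mathbb P}_{n-\gamma}$ is bijective, with inverse denoted $\mathcal S_n$. Let $\mathcal R=T_{p-\gamma}\circ\mathcal L-\mathcal L_*$ on $\mathbb P_p$, and for $n\in\{0,\dots,p\}$ and $l\in\{0,\dots,p-\gamma\}$ let $\mathcal R_{l,n}:\widetilde{\mathbb P}_n\to\widetilde{\mathbb P}_l$ be the component of $\mathcal R|_{\widetilde{\mathbb P}_n}$ in $\widetilde{\mathbb P}_l$, so that $\mathcal R(x_n)=\sum_{l=0}^{p-\gamma}\mathcal R_{l,n}(x_n)$ for $x_n\in\widetilde{\mathbb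 P}_n$ (where only the terms with $l\ge n-\gamma+1$ are present when $n\ge\gamma$). Let $\mathbb U=\big(\bigoplus_{n=0}^{\gamma-1}\widetilde{\mathbb P}_n\big)\oplus\big(\bigoplus_{k=\gamma}^p\mathbb U_k\big)$. For an input $U=\sum_{k=0}^pu_k\in\mathbb U$, with $u_k\in\widetilde{\mathbb P}_k$ for $0\le k\le\gamma-1$ and $u_k\in\mathbb U_k$ for $\gamma\le k\le p$, consider the algorithm which sets $x_k:=u_k$ for $k=0,\dots,\gamma-1$, then successively for $k=\gamma,\dots,p$ $$x_k:=u_k-\mathcal S_k\Big(\sum_{j=0}^{k-1}\mathcal R_{k-\gamma,j}(x_j)+\mathcal L_*(u_k)\Big),$$ and outputs $X=\sum_{k=0}^px_k$. Then the algorithm computes the components $x_n\in\widetilde{\mathbb P}_n$, $0\le n\le p$, of a generic element $X$ of $\mathbb{QT}_p$; that is, $\mathbb{QT}_p$ is exactly the set of outputs as the input $U$ ranges over $\mathbb U$. Moreover, for any basis $\{Y_i,\ i\in I\}$ of $\mathbb U$, letting $X_i$ be the output of the algorithm for the input $Y_i$ for each $i\in I$, the set $\{X_i,\ i\in I\}$ forms a basis of $\mathbb{QT}_p$. As a consequence, $\dim\mathbb{QT}_p=\dim\mathbb P_p-\dim\mathbb P_{p-\gamma}$.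
   Context: $\mathbb N$ is the set of positive integers and $\mathbb N_0=\mathbb N\cup\{0\}$; $\mathbb K=\mathbb R$ or $\mathbb C$. $\mathcal C^n(\mathbf x_0)$ is the space of ($\mathbb K$-valued) functions with continuous derivatives up to order $n$ in a neighborhood of $\mathbf x_0$. $\mathbb P_p$ is the space of polynomials in $d$ variables of degree at most $p$ over $\mathbb K$. $\widetilde{\mathbb P}_l$ is the space of homogeneous polynomials of degree $l$ in the shifted variable $\mathbf X-\mathbf x_0$, i.e. the span of $(\mathbf X-\mathbf x_0)^{\mathbf i}$ with $|\mathbf i|=l$, so $\mathbb P_p=\bigoplus_{l=0}^p\widetilde{\mathbb P}_l$. For $\varphi\in\mathcal C^k(\mathbf x_0)$, $T_k[\varphi]=\sum_{l=0}^k\sum_{|\mathbf i|=l}\frac1{\mathbf i!}\partial^{\mathbf i}\varphi(\mathbf x_0)(\mathbf X-\mathbf x_0)^{\mathbf i}\in\mathbb P_k$ is its $k$th Taylor polynomial at $\mathbf x_0$. The quasi-Trefftz space of order $p$ is $\mathbb{QT}_p=\{\Pi\in\mathbb P_p : T_{p-\gamma}[\mathcal L\Pi]=0\}$. *)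

theory Defs
  imports "HOL-Analysis.Analysis" "HOL-Library.Function_Algebras"
begin

text \<open>
  The ground field is a type \<open>'k\<close> of class \<open>real_normed_field\<close>, of which \<open>real\<close> and \<open>complex\<close> are
  instances (by Gelfand--Mazur the only ones, up to isometric isomorphism). The space dimension is
  \<open>CARD('d)\<close>, and multi-indices are functions \<open>'d \<Rightarrow> nat\<close>. Addition, subtraction and finite sums of
  functions are the pointwise ones of \<open>Function_Algebras\<close>.
\<close>

section \<open>Function spaces over the ground field\<close>

definition fscale :: "'k::field \<Rightarrow> ('a \<Rightarrow> 'k) \<Rightarrow> 'a \<Rightarrow> 'k" where
  "fscale c f = (\<lambda>x. c * f x)"

interpretation fs: vector_space "fscale :: 'k::field \<Rightarrow> ('a \<Rightarrow> 'k) \<Rightarrow> 'a \<Rightarrow> 'k"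
  by unfold_locales (auto simp: fscale_def fun_eq_iff algebra_simps)

definition is_direct_sum :: "('a \<Rightarrow> 'k::field) set \<Rightarrow> ('a \<Rightarrow> 'k) set \<Rightarrow> ('a \<Rightarrow> 'k) set \<Rightarrow> bool" where
  "is_direct_sum W U V \<longleftrightarrow>
     fs.subspace U \<and> fs.subspace V \<and> U \<inter> V = {0} \<and> W = {u + v | u v. u \<in> U \<and> v \<in> V}"

definition is_basis :: "'i set \<Rightarrow> ('i \<Rightarrow> 'a \<Rightarrow> 'k::field) \<Rightarrow> ('a \<Rightarrow> 'k) set \<Rightarrow> bool" where
  "is_basis I Y W \<longleftrightarrow> inj_on Y I \<and> fs.independent (Y ` I) \<and> fs.span (Y ` I) = W"

definition graded_sum :: "nat \<Rightarrow> (nat \<Rightarrow> ('a \<Rightarrow> 'k::field) set) \<Rightarrow> ('a \<Rightarrow> 'k) set" where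
  "graded_sum N W = {\<Sum>k\<le>N. g k | g. \<forall>k\<le>N. g k \<in> W k}"

text \<open>The components of \<open>f\<close> in \<open>W 0 \<oplus> \<dots> \<oplus> W N\<close>; meaningful when this sum is direct and contains \<open>f\<close>.\<close>

definition components ::
    "nat \<Rightarrow> (nat \<Rightarrow> ('a \<Rightarrow> 'k::field) set) \<Rightarrow> ('a \<Rightarrow> 'k) \<Rightarrow> nat \<Rightarrow> 'a \<Rightarrow> 'k" where
  "components N W f =
     (THE g. (\<forall>k\<le>N. g k \<in> W k) \<and> (\<forall>k>N. g k = 0) \<and> f = (\<Sum>k\<le>N. g k))"


section \<open>Multi-indices and polynomial spaces\<close>

definition multi_indices :: "nat \<Rightarrow> ('d::finite \<Rightarrow> nat) set" where
  "multi_indices m = {j. (\<Sum>k\<in>UNIV. j k) = m}"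

definition multi_fact :: "('d::finite \<Rightarrow> nat) \<Rightarrow> nat" where
  "multi_fact j = (\<Prod>k\<in>UNIV. fact (j k))"

definition shifted_monom :: "real ^ 'd \<Rightarrow> ('d \<Rightarrow> nat) \<Rightarrow> real ^ 'd \<Rightarrow> 'k::real_normed_field" where
  "shifted_monom a j = (\<lambda>x. \<Prod>k\<in>UNIV. of_real (x $ k - a $ k) ^ j k)"

definition polys :: "nat \<Rightarrow> (real ^ 'd \<Rightarrow> 'k::real_normed_field) set" where
  "polys p = fs.span (\<Union>m\<le>p. shifted_monom 0 ` multi_indices m)"

definition hom_polys :: "real ^ 'd \<Rightarrow> nat \<Rightarrow> (real ^ 'd \<Rightarrow> 'k::real_normed_field) set" where
  "hom_polys x0 l = fs.span (shifted_monom x0 ` multi_indices l)"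


section \<open>Partial derivatives and Taylor polynomials\<close>

definition partial_deriv ::
    "'d::finite \<Rightarrow> (real ^ 'd \<Rightarrow> 'k::real_normed_field) \<Rightarrow> real ^ 'd \<Rightarrow> 'k" where
  "partial_deriv i f x = vector_derivative (\<lambda>t. f (x + t *\<^sub>R axis i 1)) (at 0)"

fun cont_diff_on ::
    "nat \<Rightarrow> (real ^ 'd) set \<Rightarrow> (real ^ 'd \<Rightarrow> 'k::real_normed_field) \<Rightarrow> bool" where
  "cont_diff_on 0 S f \<longleftrightarrow> continuous_on S f"
| "cont_diff_on (Suc n) S f \<longleftrightarrow> continuous_on S f \<and>
     (\<forall>i. (\<forall>x\<in>S. (\<lambda>t. f (x + t *\<^sub>R axis i 1)) differentiable (at 0)) \<and>
          cont_diff_on n S (partial_deriv i f))"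

definition cont_diff_near ::
    "nat \<Rightarrow> real ^ 'd \<Rightarrow> (real ^ 'd \<Rightarrow> 'k::real_normed_field) \<Rightarrow> bool" where
  "cont_diff_near n x0 f \<longleftrightarrow> (\<exists>S. open S \<and> x0 \<in> S \<and> cont_diff_on n S f)"

text \<open>
  Partial derivatives in the directions of the coordinates are applied in one fixed order of the
  coordinates; by symmetry of mixed partial derivatives the choice of this order is immaterial
  where \<open>f\<close> has continuous derivatives up to order \<open>\<Sum>k\<in>UNIV. j k\<close>.
\<close>

definition coord_list :: "'d::finite list" where
  "coord_list = (SOME ks. distinct ks \<and> set ks = UNIV)"

definition multi_deriv ::
    "('d::finite \<Rightarrow> nat) \<Rightarrow> (real ^ 'd \<Rightarrow> 'k::real_normed_field) \<Rightarrow> real ^ 'd \<Rightarrow> 'k" where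
  "multi_deriv j f = foldr (\<lambda>k. partial_deriv k ^^ j k) coord_list f"

definition taylor ::
    "nat \<Rightarrow> real ^ 'd \<Rightarrow> (real ^ 'd \<Rightarrow> 'k::real_normed_field) \<Rightarrow> real ^ 'd \<Rightarrow> 'k" where
  "taylor k x0 f = (\<Sum>l\<le>k. \<Sum>i\<in>multi_indices l.
     fscale (1 / of_nat (multi_fact i) * multi_deriv i f x0) (shifted_monom x0 i))"


section \<open>Differential operators and the quasi-Trefftz space\<close>

definition diff_op :: "nat \<Rightarrow> (('d::finite \<Rightarrow> nat) \<Rightarrow> real ^ 'd \<Rightarrow> 'k) \<Rightarrow>
    (real ^ 'd \<Rightarrow> 'k::real_normed_field) \<Rightarrow> real ^ 'd \<Rightarrow> 'k" where
  "diff_op \<gamma> c f = (\<lambda>x. \<Sum>m\<le>\<gamma>. \<Sum>j\<in>multi_indices m. c j x * multi_deriv j f x)"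

definition frozen_op :: "nat \<Rightarrow> (('d::finite \<Rightarrow> nat) \<Rightarrow> real ^ 'd \<Rightarrow> 'k) \<Rightarrow> real ^ 'd \<Rightarrow>
    (real ^ 'd \<Rightarrow> 'k::real_normed_field) \<Rightarrow> real ^ 'd \<Rightarrow> 'k" where
  "frozen_op \<gamma> c x0 f = (\<lambda>x. \<Sum>j\<in>multi_indices \<gamma>. c j x0 * multi_deriv j f x)"

definition quasi_Trefftz :: "nat \<Rightarrow> nat \<Rightarrow> (('d::finite \<Rightarrow> nat) \<Rightarrow> real ^ 'd \<Rightarrow> 'k) \<Rightarrow> real ^ 'd \<Rightarrow>
    (real ^ 'd \<Rightarrow> 'k::real_normed_field) set" where
  "quasi_Trefftz p \<gamma> c x0 = {f \<in> polys p. taylor (p - \<gamma>) x0 (diff_op \<gamma> c f) = 0}"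

definition rem_op :: "nat \<Rightarrow> nat \<Rightarrow> (('d::finite \<Rightarrow> nat) \<Rightarrow> real ^ 'd \<Rightarrow> 'k) \<Rightarrow> real ^ 'd \<Rightarrow>
    (real ^ 'd \<Rightarrow> 'k::real_normed_field) \<Rightarrow> real ^ 'd \<Rightarrow> 'k" where
  "rem_op p \<gamma> c x0 f = taylor (p - \<gamma>) x0 (diff_op \<gamma> c f) - frozen_op \<gamma> c x0 f"

text \<open>
  The component of degree \<open>l\<close> of the remainder operator. The block \<open>\<R>\<^bsub>l,n\<^esub>\<close> is its restriction to
  \<open>hom_polys x0 n\<close>.
\<close>

definition rem_block :: "nat \<Rightarrow> nat \<Rightarrow> (('d::finite \<Rightarrow> nat) \<Rightarrow> real ^ 'd \<Rightarrow> 'k) \<Rightarrow> real ^ 'd \<Rightarrow>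
    nat \<Rightarrow> (real ^ 'd \<Rightarrow> 'k::real_normed_field) \<Rightarrow> real ^ 'd \<Rightarrow> 'k" where
  "rem_block p \<gamma> c x0 l f = components (p - \<gamma>) (hom_polys x0) (rem_op p \<gamma> c x0 f) l"


section \<open>The algorithm\<close>

definition input_summand :: "nat \<Rightarrow> real ^ 'd \<Rightarrow> (nat \<Rightarrow> (real ^ 'd \<Rightarrow> 'k) set) \<Rightarrow> nat \<Rightarrow>
    (real ^ 'd \<Rightarrow> 'k::real_normed_field) set" where
  "input_summand \<gamma> x0 U k = (if k < \<gamma> then hom_polys x0 k else U k)"

definition input_space :: "nat \<Rightarrow> nat \<Rightarrow> real ^ 'd \<Rightarrow> (nat \<Rightarrow> (real ^ 'd \<Rightarrow> 'k) set) \<Rightarrow>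
    (real ^ 'd \<Rightarrow> 'k::real_normed_field) set" where
  "input_space p \<gamma> x0 U = graded_sum p (input_summand \<gamma> x0 U)"

fun alg_step :: "nat \<Rightarrow> nat \<Rightarrow> (('d::finite \<Rightarrow> nat) \<Rightarrow> real ^ 'd \<Rightarrow> 'k) \<Rightarrow> real ^ 'd \<Rightarrow>
    (nat \<Rightarrow> (real ^ 'd \<Rightarrow> 'k) set) \<Rightarrow> (nat \<Rightarrow> real ^ 'd \<Rightarrow> 'k) \<Rightarrow> nat \<Rightarrow>
    real ^ 'd \<Rightarrow> 'k::real_normed_field" where
  "alg_step p \<gamma> c x0 V u k =
     (if k < \<gamma> then u k
      else u k - the_inv_into (V k) (frozen_op \<gamma> c x0)
             ((\<Sum>j\<in>{..<k}. rem_block p \<gamma> c x0 (k - \<gamma>) (alg_step p \<gamma> c x0 V u j))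
              + frozen_op \<gamma> c x0 (u k)))"

declare alg_step.simps [simp del]

definition alg_component :: "nat \<Rightarrow> nat \<Rightarrow> (('d::finite \<Rightarrow> nat) \<Rightarrow> real ^ 'd \<Rightarrow> 'k) \<Rightarrow> real ^ 'd \<Rightarrow>
    (nat \<Rightarrow> (real ^ 'd \<Rightarrow> 'k) set) \<Rightarrow> (nat \<Rightarrow> (real ^ 'd \<Rightarrow> 'k) set) \<Rightarrow>
    (real ^ 'd \<Rightarrow> 'k) \<Rightarrow> nat \<Rightarrow> real ^ 'd \<Rightarrow> 'k::real_normed_field" where
  "alg_component p \<gamma> c x0 U V f =
     alg_step p \<gamma> c x0 V (components p (input_summand \<gamma> x0 U) f)"

definition alg_output :: "nat \<Rightarrow> nat \<Rightarrow> (('d::finite \<Rightarrow> nat) \<Rightarrow> real ^ 'd \<Rightarrow> 'k) \<Rightarrow> real ^ 'd \<Rightarrow>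
    (nat \<Rightarrow> (real ^ 'd \<Rightarrow> 'k) set) \<Rightarrow> (nat \<Rightarrow> (real ^ 'd \<Rightarrow> 'k) set) \<Rightarrow>
    (real ^ 'd \<Rightarrow> 'k) \<Rightarrow> real ^ 'd \<Rightarrow> 'k::real_normed_field" where
  "alg_output p \<gamma> c x0 U V f = (\<Sum>k\<le>p. alg_component p \<gamma> c x0 U V f k)"

end

theory Submission
  imports Defs
begin

text \<open>
  Write \<open>P = polys p\<close>, let \<open>A\<close> be the input space, let \<open>W\<close> be the direct sum of the spaces \<open>V k\<close>
  with \<open>\<gamma> \<le> k \<le> p\<close>, and let \<open>Q\<close> be the quasi-Trefftz space. The decompositions of the homogeneous
  pieces add up to \<open>P = A \<oplus> W\<close>. The point of the proof is that \<open>P = Q \<oplus> W\<close> holds as well and that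
  the algorithm is the projection onto \<open>Q\<close> along \<open>W\<close>, restricted to \<open>A\<close>. A projection along a common
  complement is a linear isomorphism \<open>A \<rightarrow> Q\<close> (\<open>projection_along_complement\<close>), so the outputs exhaust
  \<open>Q\<close> and bases are carried to bases. Linearity and injectivity of the recursion are consequences
  of this description.

  What has to be known about the algorithm is therefore only that its output lies in \<open>Q\<close> and differs
  from its input by an element of \<open>W\<close>, together with \<open>Q \<inter> W = {0}\<close>. All of this comes from the
  triangular shape of the equations that define \<open>Q\<close>. For \<open>X = \<Sum>k\<le>p. x k\<close> with \<open>x k\<close> homogeneous of
  degree \<open>k\<close>, the degree \<open>k - \<gamma>\<close> part of the Taylor polynomial of the operator applied to \<open>X\<close> is
  the constant-coefficient operator on \<open>x k\<close> plus the remainder blocks on those \<open>x j\<close> with \<open>j < k\<close>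
  (\<open>quasi_Trefftz_graded_sum_iff\<close>). Step \<open>k\<close> of the algorithm solves exactly this equation by a
  correction in \<open>V k\<close> (\<open>alg_step_solves\<close>). An element of \<open>Q \<inter> W\<close> vanishes degree by degree, because
  the constant-coefficient operator is injective on each \<open>V k\<close> (\<open>quasi_Trefftz_Int_complement\<close>).

  The triangular shape is the analytic part. Let \<open>c\<close> be a coefficient and \<open>q\<close> homogeneous of degree
  \<open>r\<close> about the centre. By the Leibniz rule, the part of degree \<open>l \<le> r\<close> of the Taylor polynomial of
  \<open>c q\<close> is \<open>0\<close> for \<open>l < r\<close> and \<open>c(x0) q\<close> for \<open>l = r\<close> (\<open>taylor_part_mult_hom_poly\<close>). The induction
  behind it distributes one partial derivative at a time over the two factors.

  For the dimension, \<open>P = Q \<oplus> W\<close> gives \<open>dim P = dim Q + dim W\<close>, and the constant-coefficient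
  operator maps \<open>W\<close> bijectively onto \<open>polys (p - \<gamma>)\<close>, being a bijection in each degree
  (\<open>dim_complement\<close>).
\<close>

section \<open>Partial derivatives and functions of class \<open>C\<^sup>n\<close>\<close>

text \<open>
  A relational form of \<open>partial_deriv\<close>, whose value is arbitrary where the derivative does not
  exist. Existence and value can then be derived by one set of rules.
\<close>

definition has_partial ::
    "'d::finite \<Rightarrow> (real ^ 'd \<Rightarrow> 'k::real_normed_field) \<Rightarrow> real ^ 'd \<Rightarrow> 'k \<Rightarrow> bool" where
  "has_partial i f x D \<longleftrightarrow> ((\<lambda>t. f (x + t *\<^sub>R axis i 1)) has_vector_derivative D) (at 0)"

lemma has_partial_imp_partial_deriv: "has_partial i f x D \<Longrightarrow> partial_deriv i f x = D"
  unfolding has_partial_def partial_deriv_def by (rule vector_derivative_at)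

lemma has_partial_partial_deriv:
  "(\<lambda>t. f (x + t *\<^sub>R axis i 1)) differentiable (at 0) \<longleftrightarrow> has_partial i f x (partial_deriv i f x)"
  unfolding has_partial_def partial_deriv_def by (rule vector_derivative_works)

lemma has_partial_const: "has_partial i (\<lambda>x. c) x 0"
  unfolding has_partial_def by (rule has_vector_derivative_const)

lemma has_partial_add:
  "has_partial i f x D \<Longrightarrow> has_partial i g x E \<Longrightarrow> has_partial i (f + g) x (D + E)"
  unfolding has_partial_def plus_fun_def by (rule has_vector_derivative_add)

lemma has_partial_mult:
  "has_partial i f x D \<Longrightarrow> has_partial i g x E \<Longrightarrow>
   has_partial i (\<lambda>x. f x * g x) x (D * g x + f x * E)"
  unfolding has_partial_def
  by (drule (1) has_vector_derivative_mult) (simp add: add.commute)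

text \<open>
  The axis line through a point of an open set stays in the set for small parameters, so the
  derivative depends only on the values in the set.
\<close>

lemma has_partial_cong:
  assumes "open S" "x \<in> S" and eq: "\<And>y. y \<in> S \<Longrightarrow> f y = g y"
  shows "has_partial i f x D \<longleftrightarrow> has_partial i g x D"
proof -
  have "continuous_on UNIV (\<lambda>t. x + t *\<^sub>R axis i 1 :: real ^ 'a)"
    by (intro continuous_intros)
  with \<open>open S\<close> have "open ((\<lambda>t. x + t *\<^sub>R axis i 1) -` S)"
    by (rule open_vimage)
  then show ?thesis
    unfolding has_partial_def
    by (intro has_vector_derivative_cong_ev refl)
      (auto simp: eventually_nhds assms intro!: exI[of _ "(\<lambda>t. x + t *\<^sub>R axis i 1) -` S"])
qed

lemma partial_deriv_cong:
  assumes "open S" "x \<in> S" and "\<And>y. y \<in> S \<Longrightarrow> f y = g y"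
  shows "partial_deriv i f x = partial_deriv i g x"
proof -
  have "has_partial i f x D \<longleftrightarrow> has_partial i g x D" for D
    using assms by (rule has_partial_cong)
  then show ?thesis
    by (simp add: has_partial_def partial_deriv_def vector_derivative_def)
qed

lemma cont_diff_on_Suc:
  "cont_diff_on (Suc n) S f \<longleftrightarrow> continuous_on S f \<and>
     (\<forall>i. (\<forall>x\<in>S. has_partial i f x (partial_deriv i f x)) \<and> cont_diff_on n S (partial_deriv i f))"
  by (simp add: has_partial_partial_deriv)

lemma cont_diff_on_cong:
  assumes "open S"
  shows "(\<And>y. y \<in> S \<Longrightarrow> f y = g y) \<Longrightarrow> cont_diff_on n S f \<longleftrightarrow> cont_diff_on n S g"
proof (induction n arbitrary: f g)
  case 0
  then show ?case by (simp cong: continuous_on_cong)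
next
  case (Suc n)
  have pd: "partial_deriv i f x = partial_deriv i g x" if "x \<in> S" for i x
    using assms that Suc.prems by (rule partial_deriv_cong)
  moreover have "cont_diff_on n S (partial_deriv i f) \<longleftrightarrow> cont_diff_on n S (partial_deriv i g)" for i
    by (rule Suc.IH) (rule pd)
  moreover have "continuous_on S f \<longleftrightarrow> continuous_on S g"
    using Suc.prems by (rule continuous_on_cong[OF refl])
  moreover have "has_partial i f x D \<longleftrightarrow> has_partial i g x D" if "x \<in> S" for i x D
    using assms that Suc.prems by (rule has_partial_cong)
  ultimately show ?case
    unfolding cont_diff_on_Suc by simp
qed

text \<open>
  Since the derivatives need to be known only on the open set, any functions with the right values
  there can serve in place of \<open>partial_deriv i f\<close>.
\<close>

lemma cont_diff_on_SucI:
  assumes "open S" "continuous_on S f"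
    and D: "\<And>i x. x \<in> S \<Longrightarrow> has_partial i f x (g i x)"
    and "\<And>i. cont_diff_on n S (g i)"
  shows "cont_diff_on (Suc n) S f"
proof -
  have "partial_deriv i f x = g i x" if "x \<in> S" for i x
    using D[OF that] by (rule has_partial_imp_partial_deriv)
  moreover from this have "cont_diff_on n S (partial_deriv i f)" for i
    using assms cont_diff_on_cong[OF \<open>open S\<close>, of "partial_deriv i f" "g i" n] by simp
  ultimately show ?thesis
    unfolding cont_diff_on_Suc using assms by simp
qed

lemma cont_diff_on_SucD: "cont_diff_on (Suc n) S f \<Longrightarrow> cont_diff_on n S f"
  by (induction n arbitrary: f) (auto simp: cont_diff_on_Suc simp del: cont_diff_on.simps(2))

lemma cont_diff_on_le: "cont_diff_on n S f \<Longrightarrow> m \<le> n \<Longrightarrow> cont_diff_on m S f"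
  by (induction n) (auto simp: le_Suc_eq intro: cont_diff_on_SucD simp del: cont_diff_on.simps(2))

lemma cont_diff_on_subset: "cont_diff_on n S f \<Longrightarrow> T \<subseteq> S \<Longrightarrow> cont_diff_on n T f"
  by (induction n arbitrary: f) (auto intro: continuous_on_subset)

lemma cont_diff_on_const: "open S \<Longrightarrow> cont_diff_on n S (\<lambda>x. c)"
proof (induction n arbitrary: c)
  case (Suc n)
  then show ?case
    by (intro cont_diff_on_SucI[where g = "\<lambda>i x. 0"] has_partial_const) auto
qed simp

lemma cont_diff_on_add:
  assumes "open S"
  shows "cont_diff_on n S f \<Longrightarrow> cont_diff_on n S g \<Longrightarrow> cont_diff_on n S (f + g)"
proof (induction n arbitrary: f g)
  case 0
  then show ?case by (auto simp: plus_fun_def intro: continuous_on_add)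
next
  case (Suc n)
  show ?case
    using Suc.prems unfolding cont_diff_on_Suc[of _ _ f] cont_diff_on_Suc[of _ _ g]
    by (intro cont_diff_on_SucI[where g = "\<lambda>i. partial_deriv i f + partial_deriv i g"] assms
        Suc.IH) (auto simp: plus_fun_def intro: continuous_on_add has_partial_add[unfolded plus_fun_def])
qed

lemma cont_diff_on_mult:
  assumes "open S"
  shows "cont_diff_on n S f \<Longrightarrow> cont_diff_on n S g \<Longrightarrow> cont_diff_on n S (\<lambda>x. f x * g x)"
proof (induction n arbitrary: f g)
  case 0
  then show ?case by (auto intro: continuous_on_mult)
next
  case (Suc n)
  have "cont_diff_on n S f" "cont_diff_on n S g"
    using Suc.prems by (auto dest: cont_diff_on_SucD simp del: cont_diff_on.simps)
  then have "cont_diff_on n S ((\<lambda>x. partial_deriv i f x * g x) + (\<lambda>x. f x * partial_deriv i g x))" for i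
    using Suc.prems unfolding cont_diff_on_Suc by (intro cont_diff_on_add assms Suc.IH) auto
  with Suc.prems show ?case
    unfolding cont_diff_on_Suc[of _ _ f] cont_diff_on_Suc[of _ _ g] plus_fun_def
    by (intro cont_diff_on_SucI[where g = "\<lambda>i x. partial_deriv i f x * g x + f x * partial_deriv i g x"]
         assms) (auto intro: continuous_on_mult has_partial_mult)
qed

lemma cont_diff_on_fscale:
  "open S \<Longrightarrow> cont_diff_on n S f \<Longrightarrow> cont_diff_on n S (fscale c f)"
  unfolding fscale_def by (intro cont_diff_on_mult cont_diff_on_const)

lemma cont_diff_on_sum:
  "open S \<Longrightarrow> (\<And>a. a \<in> A \<Longrightarrow> cont_diff_on n S (f a)) \<Longrightarrow> cont_diff_on n S (\<Sum>a\<in>A. f a)"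
  by (induction A rule: infinite_finite_induct)
    (auto simp: zero_fun_def intro: cont_diff_on_add cont_diff_on_const)

section \<open>Iterated partial derivatives\<close>

definition iterated_partial ::
    "'d::finite list \<Rightarrow> (real ^ 'd \<Rightarrow> 'k::real_normed_field) \<Rightarrow> real ^ 'd \<Rightarrow> 'k" where
  "iterated_partial ks = foldr partial_deriv ks"

lemma iterated_partial_Nil [simp]: "iterated_partial [] f = f"
  and iterated_partial_Cons: "iterated_partial (k # ks) f = partial_deriv k (iterated_partial ks f)"
  and iterated_partial_snoc: "iterated_partial (ks @ [k]) f = iterated_partial ks (partial_deriv k f)"
  by (simp_all add: iterated_partial_def)

lemma iterated_partial_cong:
  assumes "open S" and "\<And>y. y \<in> S \<Longrightarrow> f y = g y"
  shows "x \<in> S \<Longrightarrow> iterated_partial ks f x = iterated_partial ks g x"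
  by (induction ks arbitrary: x)
    (use assms in \<open>auto simp: iterated_partial_Cons intro: partial_deriv_cong\<close>)

text \<open>
  The induction peels off the innermost derivative, the last letter of the word, because the class
  \<open>C\<^sup>n\<close> is defined by recursion on the derivative that is taken first.
\<close>

lemma iterated_partial_add:
  assumes "open S" "x \<in> S"
  shows "cont_diff_on (length ks) S f \<Longrightarrow> cont_diff_on (length ks) S g \<Longrightarrow>
    iterated_partial ks (f + g) x = iterated_partial ks f x + iterated_partial ks g x"
proof (induction ks arbitrary: f g rule: rev_induct)
  case (snoc k ks)
  have "partial_deriv k (f + g) y = (partial_deriv k f + partial_deriv k g) y" if "y \<in> S" for y
    using snoc.prems that unfolding length_append_singleton cont_diff_on_Suc
    by (auto intro!: has_partial_imp_partial_deriv has_partial_add)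
  then have "iterated_partial ks (partial_deriv k (f + g)) x =
      iterated_partial ks (partial_deriv k f + partial_deriv k g) x"
    using iterated_partial_cong[OF assms(1) _ assms(2)] by blast
  also have "\<dots> = iterated_partial ks (partial_deriv k f) x + iterated_partial ks (partial_deriv k g) x"
    using snoc.prems unfolding length_append_singleton cont_diff_on_Suc by (intro snoc.IH) auto
  finally show ?case
    unfolding iterated_partial_snoc .
qed simp

lemma iterated_partial_fscale:
  assumes "open S" "x \<in> S"
  shows "cont_diff_on (length ks) S f \<Longrightarrow>
    iterated_partial ks (fscale a f) x = a * iterated_partial ks f x"
proof (induction ks arbitrary: f rule: rev_induct)
  case (snoc k ks)
  have "partial_deriv k (fscale a f) y = fscale a (partial_deriv k f) y" if "y \<in> S" for y
    using snoc.prems that has_partial_mult[OF has_partial_const, of k f y "partial_deriv k f y" a]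
    unfolding length_append_singleton cont_diff_on_Suc fscale_def
    by (auto intro!: has_partial_imp_partial_deriv)
  then have "iterated_partial ks (partial_deriv k (fscale a f)) x =
      iterated_partial ks (fscale a (partial_deriv k f)) x"
    using iterated_partial_cong[OF assms(1) _ assms(2)] by blast
  with snoc show ?case
    unfolding length_append_singleton cont_diff_on_Suc by (simp add: iterated_partial_snoc)
qed (simp add: fscale_def)

text \<open>
  Spelling out a multi-index as a word makes inductions possible that treat one derivative at a time.
\<close>

definition deriv_word :: "('d::finite \<Rightarrow> nat) \<Rightarrow> 'd list" where
  "deriv_word j = concat (map (\<lambda>k. replicate (j k) k) coord_list)"

lemma coord_list: "distinct (coord_list :: 'd::finite list)" "set (coord_list :: 'd list) = UNIV"
proof -
  have "\<exists>ks :: 'd list. distinct ks \<and> set ks = UNIV"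
    using finite_distinct_list[of "UNIV :: 'd set"] by auto
  then show "distinct (coord_list :: 'd::finite list)" "set (coord_list :: 'd list) = UNIV"
    unfolding coord_list_def by (auto dest!: someI_ex[where P = "\<lambda>ks. distinct ks \<and> set ks = UNIV"])
qed

lemma multi_deriv_eq_iterated_partial: "multi_deriv j f = iterated_partial (deriv_word j) f"
proof -
  have rep: "foldr partial_deriv (replicate m k) g = (partial_deriv k ^^ m) g"
    for m k and g :: "real ^ 'a \<Rightarrow> 'b"
    by (induction m) auto
  have "foldr (\<lambda>k. partial_deriv k ^^ j k) ks f =
      foldr partial_deriv (concat (map (\<lambda>k. replicate (j k) k) ks)) f" for ks
    by (induction ks) (auto simp: rep)
  then show ?thesis
    unfolding multi_deriv_def iterated_partial_def deriv_word_def .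
qed

lemma length_deriv_word: "length (deriv_word j) = (\<Sum>k\<in>UNIV. j k)"
  using coord_list[where 'd = 'a]
  by (simp add: deriv_word_def length_concat comp_def sum_list_distinct_conv_sum_set)

section \<open>Shifted monomials\<close>

text \<open>
  As simplification rules, the pointwise equations also act on functions in argument position, which
  become abstractions to which linearity of an operator no longer applies.
\<close>

declare plus_fun_apply [simp del] zero_fun_apply [simp del] minus_apply [simp del]

lemma sum_apply: "(\<Sum>a\<in>A. f a) x = (\<Sum>a\<in>A. f a x)"
  by (induction A rule: infinite_finite_induct) (simp_all add: plus_fun_apply zero_fun_apply)

lemma fscale_apply: "fscale c f x = c * f x"
  by (simp add: fscale_def)

lemmas fun_apply = plus_fun_apply zero_fun_apply minus_apply fscale_apply

lemma shifted_monom_remove: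
  "shifted_monom a j y =
    of_real ((y $ i - a $ i) ^ j i) * (\<Prod>k\<in>UNIV - {i}. of_real (y $ k - a $ k) ^ j k)"
  unfolding shifted_monom_def by (subst prod.remove[of UNIV i]) auto

text \<open>
  Along the \<open>i\<close>-th axis only the \<open>i\<close>-th factor varies. For \<open>j i = 0\<close> the truncated exponent is
  harmless, since the factor \<open>of_nat (j i)\<close> vanishes.
\<close>

lemma has_partial_shifted_monom:
  "has_partial i (shifted_monom a j) x (of_nat (j i) * shifted_monom a (j(i := j i - 1)) x)"
proof -
  define C :: 'b where "C = (\<Prod>k\<in>UNIV - {i}. of_real (x $ k - a $ k) ^ j k)"
  have "((\<lambda>t. (x $ i + t - a $ i) ^ j i) has_field_derivative
      of_nat (j i) * (x $ i - a $ i) ^ (j i - 1)) (at 0)"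
    by (auto intro!: derivative_eq_intros)
  then have "((\<lambda>t. of_real ((x $ i + t - a $ i) ^ j i) * C) has_vector_derivative
      of_real (of_nat (j i) * (x $ i - a $ i) ^ (j i - 1)) * C) (at 0)"
    by (intro has_vector_derivative_mult_left has_vector_derivative_of_real)
  moreover have "shifted_monom a j (x + t *\<^sub>R axis i 1) = of_real ((x $ i + t - a $ i) ^ j i) * C" for t
    unfolding shifted_monom_remove[of a j _ i] C_def by (simp add: axis_def)
  moreover have "shifted_monom a (j(i := j i - 1)) x = of_real ((x $ i - a $ i) ^ (j i - 1)) * C"
    unfolding shifted_monom_remove[of a _ _ i] C_def by simp
  ultimately show ?thesis
    unfolding has_partial_def by (simp add: mult.assoc)
qed

lemma partial_deriv_fscale_shifted_monom:
  "partial_deriv i (fscale c (shifted_monom a j)) =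
    fscale (c * of_nat (j i)) (shifted_monom a (j(i := j i - 1)))"
proof
  fix x
  have "has_partial i (\<lambda>y. c * shifted_monom a j y) x
      (0 * shifted_monom a j x + c * (of_nat (j i) * shifted_monom a (j(i := j i - 1)) x))"
    by (intro has_partial_mult has_partial_const has_partial_shifted_monom)
  then show "partial_deriv i (fscale c (shifted_monom a j)) x =
      fscale (c * of_nat (j i)) (shifted_monom a (j(i := j i - 1))) x"
    by (simp add: has_partial_imp_partial_deriv fscale_def mult.assoc)
qed

text \<open>
  The product is the falling factorial of \<open>j i\<close>. With truncated subtraction it contains a factor \<open>0\<close>
  as soon as \<open>r > j i\<close>, so the formula covers this case too.
\<close>

lemma partial_deriv_funpow_fscale_shifted_monom:
  "(partial_deriv i ^^ r) (fscale c (shifted_monom a j)) =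
    fscale (c * of_nat (\<Prod>t<r. j i - t)) (shifted_monom a (j(i := j i - r)))"
proof (induction r)
  case (Suc r)
  have "(j(i := j i - r))(i := j i - r - 1) = j(i := j i - Suc r)"
    by simp
  moreover have "c * of_nat (\<Prod>t<r. j i - t) * of_nat (j i - r) = c * (of_nat (\<Prod>t<Suc r. j i - t) :: 'b)"
    by (simp add: mult.assoc)
  ultimately show ?case
    using partial_deriv_fscale_shifted_monom[of i "c * of_nat (\<Prod>t<r. j i - t)" a "j(i := j i - r)"]
    by (simp add: Suc del: fun_upd_apply of_nat_prod) (simp del: of_nat_prod)
qed simp

lemma multi_deriv_shifted_monom:
  "multi_deriv i (shifted_monom a j) =
    fscale (of_nat (\<Prod>k\<in>UNIV. \<Prod>t<i k. j k - t)) (shifted_monom a (\<lambda>k. j k - i k))"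
proof -
  have "distinct ks \<Longrightarrow> foldr (\<lambda>k. partial_deriv k ^^ i k) ks (shifted_monom a j) =
    fscale (of_nat (\<Prod>k\<in>set ks. \<Prod>t<i k. j k - t))
      (shifted_monom a (\<lambda>k. if k \<in> set ks then j k - i k else j k) :: real ^ 'a \<Rightarrow> 'b)" for ks
  proof (induction ks)
    case (Cons k ks)
    then have "(\<lambda>l. if l \<in> set ks then j l - i l else j l)(k := j k - i k) =
        (\<lambda>l. if l \<in> set (k # ks) then j l - i l else j l)"
      by (auto simp: fun_eq_iff)
    with Cons show ?case
      by (simp add: partial_deriv_funpow_fscale_shifted_monom mult.commute)
  qed simp
  from this[OF coord_list(1)] show ?thesis
    by (simp add: multi_deriv_def coord_list(2))
qed

lemma shifted_monom_center: "shifted_monom a j a = (if j = (\<lambda>k. 0) then 1 else 0)"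
  by (auto simp: shifted_monom_def fun_eq_iff)

text \<open>
  The derivatives at the centre, divided by the factorials, are the functionals dual to the monomials.
  If \<open>i \<noteq> j\<close>, then either some \<open>i k > j k\<close> and the derivative is zero, or some \<open>i k < j k\<close> and a
  positive power of a coordinate remains, which vanishes at the centre.
\<close>

lemma multi_deriv_shifted_monom_center:
  "multi_deriv i (shifted_monom a j) a = (if i = j then of_nat (multi_fact i) else 0)"
proof (cases "\<forall>k. i k = j k")
  case True
  then have "i = j" by auto
  then show ?thesis
    by (simp add: multi_deriv_shifted_monom fscale_apply shifted_monom_center multi_fact_def
        fact_prod_rev lessThan_atLeast0 del: of_nat_prod)
next
  case False
  then obtain k where k: "i k \<noteq> j k" by auto
  show ?thesis
  proof (cases "j k < i k")
    case True
    then have "(\<Prod>t<i k. j k - t) = 0" by auto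
    then have "(\<Prod>k\<in>UNIV. \<Prod>t<i k. j k - t) = 0"
      by (metis UNIV_I finite prod_zero)
    then show ?thesis
      using k by (auto simp: multi_deriv_shifted_monom fun_apply simp del: of_nat_prod prod_zero_iff)
  next
    case False
    with k have "j k - i k \<noteq> 0" by simp
    then have "(\<lambda>k. j k - i k) \<noteq> (\<lambda>k. 0)" by metis
    with k show ?thesis by (auto simp: multi_deriv_shifted_monom fscale_apply shifted_monom_center)
  qed
qed

section \<open>Smooth functions and homogeneous polynomials\<close>

definition smooth :: "(real ^ 'd \<Rightarrow> 'k::real_normed_field) \<Rightarrow> bool" where
  "smooth f \<longleftrightarrow> (\<forall>n. cont_diff_on n UNIV f)"

lemma smooth_cont_diff_on: "smooth f \<Longrightarrow> cont_diff_on n S f"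
  unfolding smooth_def by (blast intro: cont_diff_on_subset)

lemma smooth_zero [simp]: "smooth 0"
  unfolding smooth_def zero_fun_def by (simp add: cont_diff_on_const)

lemma smooth_add: "smooth f \<Longrightarrow> smooth g \<Longrightarrow> smooth (f + g)"
  unfolding smooth_def by (simp add: cont_diff_on_add)

lemma smooth_fscale: "smooth f \<Longrightarrow> smooth (fscale c f)"
  unfolding smooth_def by (simp add: cont_diff_on_fscale)

lemma smooth_sum: "(\<And>a. a \<in> A \<Longrightarrow> smooth (f a)) \<Longrightarrow> smooth (\<Sum>a\<in>A. f a)"
  unfolding smooth_def by (simp add: cont_diff_on_sum)

lemma smooth_partial_deriv: "smooth f \<Longrightarrow> smooth (partial_deriv k f)"
  unfolding smooth_def by (metis cont_diff_on.simps(2))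

lemma smooth_iterated_partial: "smooth f \<Longrightarrow> smooth (iterated_partial ks f)"
  by (induction ks) (auto simp: iterated_partial_Cons smooth_partial_deriv)

lemma smooth_shifted_monom: "smooth (shifted_monom a j)"
proof -
  have "cont_diff_on n UNIV (shifted_monom a j :: real ^ 'a \<Rightarrow> 'b)" for n
  proof (induction n arbitrary: j)
    case 0
    show ?case by (auto simp: shifted_monom_def intro!: continuous_intros)
  next
    case (Suc n)
    have "cont_diff_on n UNIV (\<lambda>x. of_nat (j i) * shifted_monom a (j(i := j i - 1)) x :: 'b)" for i
      using cont_diff_on_fscale[OF open_UNIV Suc] by (simp add: fscale_def)
    then show ?case
      by (intro cont_diff_on_SucI[where
            g = "\<lambda>i x. of_nat (j i) * shifted_monom a (j(i := j i - 1)) x"] has_partial_shifted_monom)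
        (auto simp: shifted_monom_def intro!: continuous_intros)
  qed
  then show ?thesis by (simp add: smooth_def)
qed

lemma subspace_smooth: "fs.subspace (Collect smooth)"
  by (auto simp: fs.subspace_def smooth_add smooth_fscale)

lemma smooth_hom_polys: "f \<in> hom_polys a n \<Longrightarrow> smooth f"
  unfolding hom_polys_def
  by (rule fs.span_induct[of f _ smooth]) (auto intro: smooth_shifted_monom subspace_smooth)

lemma iterated_partial_smooth_add:
  "smooth f \<Longrightarrow> smooth g \<Longrightarrow> iterated_partial ks (f + g) = iterated_partial ks f + iterated_partial ks g"
  using iterated_partial_add[OF open_UNIV UNIV_I, of ks f g] by (auto simp: smooth_def fun_eq_iff fun_apply)

lemma iterated_partial_smooth_fscale:
  "smooth f \<Longrightarrow> iterated_partial ks (fscale c f) = fscale c (iterated_partial ks f)"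
  using iterated_partial_fscale[OF open_UNIV UNIV_I, of ks f c] by (auto simp: smooth_def fun_eq_iff fun_apply)

lemma iterated_partial_zero [simp]: "iterated_partial ks 0 = 0"
  using iterated_partial_smooth_fscale[of 0 ks 0] by simp

lemma subspace_hom_polys: "fs.subspace (hom_polys a n)"
  unfolding hom_polys_def by (rule fs.subspace_span)

lemma shifted_monom_in_hom_polys: "j \<in> multi_indices n \<Longrightarrow> shifted_monom a j \<in> hom_polys a n"
  unfolding hom_polys_def by (rule fs.span_base) simp

lemma sum_decrement:
  fixes j :: "'d::finite \<Rightarrow> nat"
  assumes "j i \<noteq> 0"
  shows "(\<Sum>k\<in>UNIV. (j(i := j i - 1)) k) = (\<Sum>k\<in>UNIV. j k) - (1::nat)"
proof -
  have "(\<Sum>k\<in>UNIV - {i}. (j(i := j i - 1)) k) = (\<Sum>k\<in>UNIV - {i}. j k)"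
    by (intro sum.cong) auto
  moreover have "(\<Sum>k\<in>UNIV. (j(i := j i - 1)) k) = (j i - 1) + (\<Sum>k\<in>UNIV - {i}. (j(i := j i - 1)) k)"
    by (subst sum.remove[of UNIV i]) auto
  moreover have "(\<Sum>k\<in>UNIV. j k) = j i + (\<Sum>k\<in>UNIV - {i}. j k)"
    by (subst sum.remove[of UNIV i]) auto
  ultimately show ?thesis
    using assms by linarith
qed

text \<open>
  Degrees are natural numbers, so the first claim places the derivative of a constant in degree \<open>0\<close>;
  the second claim says what it really is.
\<close>

lemma partial_deriv_hom_polys:
  assumes "f \<in> hom_polys a n"
  shows "partial_deriv i f \<in> hom_polys a (n - 1)" and "n = 0 \<Longrightarrow> partial_deriv i f = 0"
proof -
  have *: "smooth f \<and> partial_deriv i f \<in> hom_polys a (n - 1) \<and> (n = 0 \<longrightarrow> partial_deriv i f = 0)"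
    using assms unfolding hom_polys_def[of a n]
  proof (induction rule: fs.span_induct_alt)
    case base
    have "partial_deriv i 0 = (0 :: real ^ 'a \<Rightarrow> 'b)"
      using iterated_partial_zero[of "[i]"] by (simp only: iterated_partial_Cons iterated_partial_Nil)
    then show ?case by (simp add: fs.subspace_0[OF subspace_hom_polys])
  next
    case (step c x y)
    then obtain j where x: "x = shifted_monom a j" and j: "(\<Sum>k\<in>UNIV. j k) = n"
      by (auto simp: multi_indices_def)
    have sm: "smooth (fscale c x)" "smooth y"
      using step.IH by (simp_all add: x smooth_shifted_monom smooth_fscale)
    have eq: "partial_deriv i (fscale c x + y) =
        fscale (c * of_nat (j i)) (shifted_monom a (j(i := j i - 1))) + partial_deriv i y"
      using iterated_partial_smooth_add[OF sm, of "[i]"]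
      by (simp add: iterated_partial_Cons x partial_deriv_fscale_shifted_monom)
    have "fscale (c * of_nat (j i)) (shifted_monom a (j(i := j i - 1))) \<in> hom_polys a (n - 1)"
    proof (cases "j i = 0")
      case True
      then show ?thesis by (simp add: fs.subspace_0[OF subspace_hom_polys])
    next
      case False
      then show ?thesis
        using sum_decrement[of j i] j
        by (intro fs.subspace_scale[OF subspace_hom_polys] shifted_monom_in_hom_polys)
          (simp add: multi_indices_def)
    qed
    moreover have "n = 0 \<Longrightarrow> j i = 0" using j by simp
    ultimately show ?case
      using step.IH sm unfolding eq
      by (auto intro: smooth_add fs.subspace_add[OF subspace_hom_polys])
  qed
  then show "partial_deriv i f \<in> hom_polys a (n - 1)" and "n = 0 \<Longrightarrow> partial_deriv i f = 0"
    by auto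
qed

lemma iterated_partial_hom_polys:
  "f \<in> hom_polys a n \<Longrightarrow> iterated_partial ks f \<in> hom_polys a (n - length ks)"
proof (induction ks arbitrary: f)
  case (Cons k ks)
  then show ?case
    using partial_deriv_hom_polys(1)[of "iterated_partial ks f" a "n - length ks" k]
    by (simp add: iterated_partial_Cons)
qed simp

lemma iterated_partial_hom_polys_eq_0:
  "f \<in> hom_polys a n \<Longrightarrow> n < length ks \<Longrightarrow> iterated_partial ks f = 0"
proof (induction ks arbitrary: f n rule: rev_induct)
  case (snoc k ks)
  show ?case
  proof (cases "n = 0")
    case True
    with snoc.prems show ?thesis by (simp add: iterated_partial_snoc partial_deriv_hom_polys(2))
  next
    case False
    with snoc.prems have "n - 1 < length ks" by simp
    with snoc.IH[OF partial_deriv_hom_polys(1)[OF snoc.prems(1)]] show ?thesis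
      by (simp add: iterated_partial_snoc)
  qed
qed simp

lemma hom_polys_center:
  assumes "f \<in> hom_polys a n" "n > 0"
  shows "f a = 0"
proof -
  have "fs.subspace {f :: real ^ 'a \<Rightarrow> 'b. f a = 0}"
    by (auto simp: fs.subspace_def fun_apply)
  moreover have "shifted_monom a j a = (0 :: 'b)" if "j \<in> multi_indices n" for j
    using that \<open>n > 0\<close> by (auto simp: shifted_monom_center multi_indices_def)
  ultimately show ?thesis
    using assms unfolding hom_polys_def by (auto intro: fs.span_induct[of f _ "\<lambda>f. f a = 0"])
qed

text \<open>
  This is the Leibniz rule at the centre \<open>a\<close>, where \<open>q\<close> vanishes together with its derivatives of
  order below its degree \<open>r\<close>. With at most \<open>r\<close> derivatives available, a term survives only if all of
  them, exactly \<open>r\<close> in number, fall on \<open>q\<close>. In the induction one derivative is distributed by the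
  product rule: if it falls on \<open>c\<close>, too few remain for \<open>q\<close>; if it falls on \<open>q\<close>, the degree and the
  number of derivatives drop together.
\<close>

lemma iterated_partial_mult_hom_poly:
  assumes S: "open S" "a \<in> S"
  shows "cont_diff_on (length ks) S c \<Longrightarrow> q \<in> hom_polys a r \<Longrightarrow> length ks \<le> r \<Longrightarrow>
    iterated_partial ks (\<lambda>x. c x * q x) a = (if length ks = r then c a * iterated_partial ks q a else 0)"
proof (induction ks arbitrary: c q r rule: rev_induct)
  case Nil
  then show ?case by (auto simp: hom_polys_center)
next
  case (snoc k ks)
  have c: "cont_diff_on (length ks) S c" "cont_diff_on (length ks) S (partial_deriv k c)"
    using snoc.prems(1) cont_diff_on_SucD by auto
  have q: "partial_deriv k q \<in> hom_polys a (r - 1)"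
    using snoc.prems(2) by (rule partial_deriv_hom_polys)
  have smooth_q: "smooth q" "smooth (partial_deriv k q)"
    using smooth_hom_polys[OF snoc.prems(2)] smooth_partial_deriv by auto
  have "partial_deriv k (\<lambda>x. c x * q x) y =
      ((\<lambda>x. partial_deriv k c x * q x) + (\<lambda>x. c x * partial_deriv k q x)) y" if "y \<in> S" for y
  proof -
    have "cont_diff_on (Suc 0) S q" using smooth_q(1) by (rule smooth_cont_diff_on)
    with snoc.prems(1) that show ?thesis
      unfolding length_append_singleton cont_diff_on_Suc
      by (auto simp: fun_apply intro!: has_partial_imp_partial_deriv has_partial_mult)
  qed
  then have "iterated_partial ks (partial_deriv k (\<lambda>x. c x * q x)) a =
      iterated_partial ks ((\<lambda>x. partial_deriv k c x * q x) + (\<lambda>x. c x * partial_deriv k q x)) a"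
    using iterated_partial_cong[OF S(1) _ S(2)] by blast
  also have "\<dots> = iterated_partial ks (\<lambda>x. partial_deriv k c x * q x) a +
      iterated_partial ks (\<lambda>x. c x * partial_deriv k q x) a"
    by (intro iterated_partial_add[OF S] cont_diff_on_mult[OF S(1)] c smooth_q[THEN smooth_cont_diff_on])
  also have "iterated_partial ks (\<lambda>x. partial_deriv k c x * q x) a = 0"
    using snoc.IH[OF c(2) snoc.prems(2)] snoc.prems(3) by simp
  also have "iterated_partial ks (\<lambda>x. c x * partial_deriv k q x) a =
      (if length ks = r - 1 then c a * iterated_partial ks (partial_deriv k q) a else 0)"
    using snoc.prems(3) by (intro snoc.IH c q) simp
  finally show ?case
    using snoc.prems(3) by (auto simp: iterated_partial_snoc)
qed

section \<open>Homogeneous parts of Taylor polynomials\<close>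

lemma finite_multi_indices: "finite (multi_indices n :: ('d::finite \<Rightarrow> nat) set)"
proof (rule finite_subset)
  show "multi_indices n \<subseteq> (UNIV :: 'd set) \<rightarrow>\<^sub>E {..n}"
    unfolding multi_indices_def by (auto intro: member_le_sum)
qed (auto intro: finite_PiE)

definition taylor_part ::
    "nat \<Rightarrow> real ^ 'd \<Rightarrow> (real ^ 'd \<Rightarrow> 'k::real_normed_field) \<Rightarrow> real ^ 'd \<Rightarrow> 'k" where
  "taylor_part l a f = (\<Sum>i\<in>multi_indices l.
     fscale (1 / of_nat (multi_fact i) * multi_deriv i f a) (shifted_monom a i))"

lemma taylor_eq_sum: "taylor k a f = (\<Sum>l\<le>k. taylor_part l a f)"
  unfolding taylor_def taylor_part_def ..

lemma taylor_part_in_hom_polys: "taylor_part l a f \<in> hom_polys a l"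
  unfolding taylor_part_def
  by (intro fs.subspace_sum fs.subspace_scale subspace_hom_polys shifted_monom_in_hom_polys)

lemma length_deriv_word_multi_indices: "i \<in> multi_indices l \<Longrightarrow> length (deriv_word i) = l"
  by (simp add: length_deriv_word multi_indices_def)

text \<open>
  The Taylor part depends on the function only through its derivatives of order \<open>l\<close> at the centre, so
  every linear relation among those passes to it. In this form one rule covers sums, scalar multiples
  and the Leibniz rule.
\<close>

lemma taylor_part_eqI:
  assumes "\<And>i. i \<in> multi_indices l \<Longrightarrow> multi_deriv i f a = c * multi_deriv i g a + multi_deriv i h a"
  shows "taylor_part l a f = fscale c (taylor_part l a g) + taylor_part l a h"
  unfolding taylor_part_def fs.scale_sum_right fs.scale_scale sum.distrib[symmetric] fs.scale_left_distrib[symmetric]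
  by (intro sum.cong refl) (simp add: assms algebra_simps)

lemma taylor_part_add:
  assumes "open S" "a \<in> S" "cont_diff_on l S f" "cont_diff_on l S g"
  shows "taylor_part l a (f + g) = taylor_part l a f + taylor_part l a g"
proof -
  have "taylor_part l a (f + g) = fscale 1 (taylor_part l a f) + taylor_part l a g"
    using assms(3,4)
    by (intro taylor_part_eqI)
      (simp add: iterated_partial_add[OF assms(1,2)] multi_deriv_eq_iterated_partial length_deriv_word_multi_indices)
  then show ?thesis by simp
qed

lemma taylor_part_zero [simp]: "taylor_part l a 0 = 0"
  by (simp add: taylor_part_def multi_deriv_eq_iterated_partial fun_apply)

lemma taylor_part_fscale:
  assumes "open S" "a \<in> S" "cont_diff_on l S f"
  shows "taylor_part l a (fscale c f) = fscale c (taylor_part l a f)"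
proof -
  have "taylor_part l a (fscale c f) = fscale c (taylor_part l a f) + taylor_part l a 0"
    using assms(3)
    by (intro taylor_part_eqI)
      (simp add: iterated_partial_fscale[OF assms(1,2)] multi_deriv_eq_iterated_partial length_deriv_word_multi_indices fun_apply)
  then show ?thesis by simp
qed

lemma taylor_part_sum:
  assumes "open S" "a \<in> S"
  shows "(\<And>b. b \<in> B \<Longrightarrow> cont_diff_on l S (f b)) \<Longrightarrow>
    taylor_part l a (\<Sum>b\<in>B. f b) = (\<Sum>b\<in>B. taylor_part l a (f b))"
  by (induction B rule: infinite_finite_induct)
    (auto simp: taylor_part_add[OF assms] cont_diff_on_sum assms(1))

lemma taylor_part_shifted_monom:
  assumes "j \<in> multi_indices n"
  shows "taylor_part l a (shifted_monom a j) = (if l = n then shifted_monom a j else 0)"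
proof -
  have nz: "of_nat (multi_fact i) \<noteq> (0 :: 'b)" for i :: "'a \<Rightarrow> nat"
    by (simp add: multi_fact_def)
  have "taylor_part l a (shifted_monom a j) =
      (\<Sum>i\<in>multi_indices l. if i = j then shifted_monom a j else (0 :: real ^ 'a \<Rightarrow> 'b))"
    unfolding taylor_part_def
    by (intro sum.cong refl) (simp add: multi_deriv_shifted_monom_center nz del: of_nat_eq_0_iff)
  also have "\<dots> = (if j \<in> multi_indices l then shifted_monom a j else 0)"
    by (simp add: sum.delta'[OF finite_multi_indices] sum.delta[OF finite_multi_indices])
  finally show ?thesis
    using assms by (auto simp: multi_indices_def)
qed

text \<open>
  A homogeneous polynomial is its own Taylor part. Hence \<open>taylor_part\<close> extracts homogeneous
  components, which makes the sum of the spaces \<open>hom_polys a l\<close> direct.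
\<close>

lemma taylor_part_hom_polys:
  assumes "q \<in> hom_polys a n"
  shows "taylor_part l a q = (if l = n then q else 0)"
proof -
  have "smooth q \<and> taylor_part l a q = (if l = n then q else 0)"
    using assms unfolding hom_polys_def
  proof (induction rule: fs.span_induct_alt)
    case (step c x y)
    then obtain j where x: "x = shifted_monom a j" and j: "j \<in> multi_indices n" by auto
    have sm: "smooth x" "smooth (fscale c x)" "smooth y"
      using step.IH by (simp_all add: x smooth_shifted_monom smooth_fscale)
    have "taylor_part l a (fscale c x + y) = fscale c (taylor_part l a x) + taylor_part l a y"
      using sm by (simp add: taylor_part_add[OF open_UNIV UNIV_I] taylor_part_fscale[OF open_UNIV UNIV_I]
          smooth_cont_diff_on)
    also have "\<dots> = (if l = n then fscale c x + y else 0)"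
      using step.IH by (simp add: x taylor_part_shifted_monom[OF j])
    finally show ?case using sm by (simp add: smooth_add)
  qed simp
  then show ?thesis ..
qed

text \<open>
  Below the degree of \<open>q\<close> nothing appears, and in the degree of \<open>q\<close> the coefficient function acts
  through its value at the centre alone. This is why the leading part of a variable-coefficient
  operator is the operator with coefficients evaluated at the centre.
\<close>

lemma taylor_part_mult_hom_poly:
  assumes "open S" "a \<in> S" "cont_diff_on l S c" "q \<in> hom_polys a r" "l \<le> r"
  shows "taylor_part l a (\<lambda>x. c x * q x) = (if l = r then fscale (c a) q else 0)"
proof -
  have "taylor_part l a (\<lambda>x. c x * q x) =
      fscale (if l = r then c a else 0) (taylor_part l a q) + taylor_part l a 0"
    using assms(3,5)
    by (intro taylor_part_eqI)
      (simp add: iterated_partial_mult_hom_poly[OF assms(1,2) _ assms(4)] multi_deriv_eq_iterated_partial length_deriv_word_multi_indices fun_apply)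
  then show ?thesis
    by (simp add: taylor_part_hom_polys[OF assms(4)])
qed

section \<open>Linear maps on subspaces, bases and dimensions\<close>

text \<open>
  The operators considered here are linear only on subspaces, because derivatives of arbitrary
  functions are not additive.
\<close>

definition linear_map_on :: "('a \<Rightarrow> 'k::field) set \<Rightarrow> (('a \<Rightarrow> 'k) \<Rightarrow> 'b \<Rightarrow> 'k) \<Rightarrow> bool" where
  "linear_map_on W f \<longleftrightarrow>
     (\<forall>x\<in>W. \<forall>y\<in>W. f (x + y) = f x + f y) \<and> (\<forall>c. \<forall>x\<in>W. f (fscale c x) = fscale c (f x))"

text \<open>
  An extension to the whole space gives access to the general theory of linear maps. It is obtained
  by prescribing the values on a basis of the subspace.
\<close>

lemma linear_map_on_extend:
  fixes f :: "('a \<Rightarrow> 'k::field) \<Rightarrow> 'b \<Rightarrow> 'k"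
  assumes W: "fs.subspace W" and f: "linear_map_on W f"
  obtains g where "Vector_Spaces.linear fscale fscale g" "\<And>x. x \<in> W \<Longrightarrow> g x = f x"
proof -
  interpret vector_space_pair "fscale :: 'k \<Rightarrow> ('a \<Rightarrow> 'k) \<Rightarrow> _" "fscale :: 'k \<Rightarrow> ('b \<Rightarrow> 'k) \<Rightarrow> _"
    by unfold_locales
  obtain B where B: "B \<subseteq> W" "fs.independent B" "W \<subseteq> fs.span B"
    by (rule fs.basis_exists[of W])
  obtain g where g: "Vector_Spaces.linear fscale fscale g" "\<And>x. x \<in> B \<Longrightarrow> g x = f x"
    using linear_independent_extend[OF B(2), of f] by blast
  have "x \<in> W \<and> g x = f x" if "x \<in> fs.span B" for x
    using that
  proof (induction rule: fs.span_induct_alt)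
    case base
    \<comment> \<open>Homogeneity with the scalar \<open>0\<close> yields \<open>f 0 = 0\<close>.\<close>
    have "0 \<in> W" using W by (rule fs.subspace_0)
    with f have "f (fscale 0 0) = fscale 0 (f 0)"
      unfolding linear_map_on_def by blast
    with \<open>0 \<in> W\<close> show ?case by (simp add: linear_0[OF g(1)])
  next
    case (step c x y)
    with B(1) W have "x \<in> W" "fscale c x \<in> W" by (auto intro: fs.subspace_scale)
    with step f W g(2)[of x] show ?case
      by (auto simp: linear_map_on_def linear_add[OF g(1)] linear_scale[OF g(1)] fs.subspace_add)
  qed
  with B(3) g(1) show ?thesis by (auto intro: that)
qed

lemma is_basis_image:
  fixes f :: "('a \<Rightarrow> 'k::field) \<Rightarrow> 'b \<Rightarrow> 'k"
  assumes "fs.subspace W" "linear_map_on W f" "inj_on f W" and Y: "is_basis I Y W"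
  shows "is_basis I (\<lambda>i. f (Y i)) (f ` W)"
proof -
  interpret vector_space_pair "fscale :: 'k \<Rightarrow> ('a \<Rightarrow> 'k) \<Rightarrow> _" "fscale :: 'k \<Rightarrow> ('b \<Rightarrow> 'k) \<Rightarrow> _"
    by unfold_locales
  obtain g where g: "Vector_Spaces.linear fscale fscale g" and gf: "\<And>x. x \<in> W \<Longrightarrow> g x = f x"
    using linear_map_on_extend[OF assms(1,2)] by blast
  have span: "fs.span (Y ` I) = W" and YW: "Y ` I \<subseteq> W"
    using Y fs.span_superset[of "Y ` I"] unfolding is_basis_def by blast+
  have inj: "inj_on g (fs.span (Y ` I))"
    using assms(3) gf unfolding span by (simp add: inj_on_def)
  have im: "(\<lambda>i. f (Y i)) ` I = g ` (Y ` I)"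
    using YW gf by (force simp: image_image)
  have "inj_on (\<lambda>i. f (Y i)) I"
    using Y inj_on_subset[OF assms(3) YW] comp_inj_on[of Y I f] by (simp add: is_basis_def comp_def)
  moreover have "fs.independent ((\<lambda>i. f (Y i)) ` I)"
    using Y unfolding im is_basis_def by (intro linear_independent_injective_image g inj) auto
  moreover have "fs.span ((\<lambda>i. f (Y i)) ` I) = f ` W"
    unfolding im linear_span_image[OF g] span using gf by auto
  ultimately show ?thesis by (simp add: is_basis_def)
qed

lemma is_basis_exists:
  assumes "fs.subspace W"
  obtains B where "is_basis B (\<lambda>b. b) W" "fs.dim W = card B"
proof -
  obtain B where B: "B \<subseteq> W" "fs.independent B" "W \<subseteq> fs.span B" "card B = fs.dim W"
    using fs.basis_exists by blast
  moreover have "fs.span B = W"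
    using B(1,3) fs.span_minimal[OF B(1) assms] by auto
  ultimately show ?thesis using that[of B] by (simp add: is_basis_def)
qed

lemma dim_is_basis: "is_basis I Y W \<Longrightarrow> fs.dim W = card I"
  unfolding is_basis_def by (metis card_image fs.dim_eq_card fs.span_span)

lemma dim_image_eq:
  assumes "fs.subspace W" "linear_map_on W f" "inj_on f W"
  shows "fs.dim (f ` W) = fs.dim W"
proof -
  obtain B where B: "is_basis B (\<lambda>b. b) W" "fs.dim W = card B"
    using is_basis_exists[OF assms(1)] .
  from dim_is_basis[OF is_basis_image[OF assms B(1)]] B(2) show ?thesis by simp
qed

text \<open>
  Bases of the two summands together form a basis of the sum: in a linear relation the two partial
  sums are opposite, so both lie in the intersection and vanish. Finiteness is essential, since
  \<open>fs.dim\<close> is \<open>0\<close> for a space without a finite basis.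
\<close>

lemma dim_direct_sum:
  fixes W :: "('a \<Rightarrow> 'k::field) set"
  assumes "is_direct_sum W A B" and T: "finite T" "W \<subseteq> fs.span T"
  shows "fs.dim W = fs.dim A + fs.dim B"
proof -
  have A: "fs.subspace A" and B: "fs.subspace B" and AB: "A \<inter> B = {0}"
    and W: "W = {u + v | u v. u \<in> A \<and> v \<in> B}"
    using assms(1) by (auto simp: is_direct_sum_def)
  have "A \<subseteq> W" "B \<subseteq> W"
    unfolding W using fs.subspace_0[OF A] fs.subspace_0[OF B] by force+
  obtain S where S: "fs.independent S" "fs.span S = A" "fs.dim A = card S"
    using is_basis_exists[OF A] unfolding is_basis_def by auto
  obtain R where R: "fs.independent R" "fs.span R = B" "fs.dim B = card R"
    using is_basis_exists[OF B] unfolding is_basis_def by auto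
  have SA: "S \<subseteq> A" and RB: "R \<subseteq> B"
    using fs.span_superset[of S] fs.span_superset[of R] unfolding S(2) R(2) .
  have fin: "finite S" "finite R"
    using fs.independent_span_bound[OF T(1) S(1)] fs.independent_span_bound[OF T(1) R(1)]
      order_trans[OF SA order_trans[OF \<open>A \<subseteq> W\<close> T(2)]] order_trans[OF RB order_trans[OF \<open>B \<subseteq> W\<close> T(2)]]
    by simp_all
  have "0 \<notin> S" using S(1) by (rule contrapos_nn) (rule fs.dependent_zero)
  moreover have "S \<inter> R \<subseteq> {0}"
    using Int_mono[OF SA RB] unfolding AB .
  ultimately have disj: "S \<inter> R = {}"
    by auto
  have "fs.independent (S \<union> R)"
  proof (rule notI)
    assume "fs.dependent (S \<union> R)"
    then have "\<exists>u. (\<exists>v\<in>S \<union> R. u v \<noteq> 0) \<and> (\<Sum>v\<in>S \<union> R. fscale (u v) v) = 0"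
      by (rule fs.dependent_finite[OF finite_UnI[OF fin], THEN iffD1])
    then obtain u where u: "\<exists>v\<in>S \<union> R. u v \<noteq> 0" and sum: "(\<Sum>v\<in>S \<union> R. fscale (u v) v) = 0"
      by (elim exE conjE) (rule that)
    define s where "s = (\<Sum>v\<in>S. fscale (u v) v)"
    define r where "r = (\<Sum>v\<in>R. fscale (u v) v)"
    have "s + r = 0" using sum disj fin by (simp add: sum.union_disjoint s_def r_def)
    then have "s = - r" by (rule eq_neg_iff_add_eq_0[THEN iffD2])
    have "s \<in> A" unfolding s_def by (intro fs.subspace_sum A fs.subspace_scale) (use SA in auto)
    have "r \<in> B" unfolding r_def by (intro fs.subspace_sum B fs.subspace_scale) (use RB in auto)
    then have "s \<in> B" unfolding \<open>s = - r\<close> by (rule fs.subspace_neg[OF B])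
    with \<open>s \<in> A\<close> have "s \<in> A \<inter> B" by (rule IntI)
    then have "s = 0" unfolding AB by (rule singletonD)
    with \<open>s + r = 0\<close> have "r = 0" by simp
    have "u v = 0" if "v \<in> S" for v
      using S(1) that fs.dependent_finite[OF fin(1)] \<open>s = 0\<close>[unfolded s_def] by metis
    moreover have "u v = 0" if "v \<in> R" for v
      using R(1) that fs.dependent_finite[OF fin(2)] \<open>r = 0\<close>[unfolded r_def] by metis
    ultimately show False using u by blast
  qed
  moreover have "fs.span (S \<union> R) = W"
    unfolding fs.span_Un S(2) R(2) W ..
  ultimately have "fs.dim W = card (S \<union> R)"
    by (metis fs.dim_eq_card fs.span_span)
  then show ?thesis
    using S(3) R(3) fin disj by (simp add: card_Un_disjoint)
qed

text \<open>
  The two conditions on \<open>f\<close> say that \<open>f u\<close> is the projection of \<open>u\<close> onto \<open>Q\<close> along \<open>V\<close>. As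
  \<open>Q \<inter> V = {0}\<close>, they determine \<open>f u\<close>, and linearity follows because \<open>f u + f w\<close> satisfies the conditions
  for \<open>u + w\<close>. Injectivity uses that \<open>u\<close> in turn is determined by \<open>f u\<close>, as the projection onto \<open>A\<close>
  along \<open>V\<close>; and projecting a given \<open>x \<in> Q\<close> onto \<open>A\<close> yields a preimage.
\<close>

lemma projection_along_complement:
  fixes P :: "('a \<Rightarrow> 'k::field) set"
  assumes sum: "is_direct_sum P A V" and Q: "fs.subspace Q" "Q \<subseteq> P" "Q \<inter> V = {0}"
    and f: "\<And>u. u \<in> A \<Longrightarrow> f u \<in> Q" "\<And>u. u \<in> A \<Longrightarrow> f u - u \<in> V"
  shows "linear_map_on A f" "inj_on f A" "f ` A = Q" "is_direct_sum P Q V"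
proof -
  have A: "fs.subspace A" and V: "fs.subspace V" and AV: "A \<inter> V = {0}"
    and P: "P = {u + v | u v. u \<in> A \<and> v \<in> V}"
    using sum by (auto simp: is_direct_sum_def)
  have uniq: "x = f u" if "x \<in> Q" "u \<in> A" "x - u \<in> V" for x u
  proof -
    have "x - f u \<in> Q" by (intro fs.subspace_diff[OF Q(1)] f(1) that)
    moreover have "(x - u) - (f u - u) \<in> V"
      by (rule fs.subspace_diff[OF V that(3) f(2)[OF that(2)]])
    then have "x - f u \<in> V" by simp
    ultimately have "x - f u \<in> Q \<inter> V" by simp
    then show ?thesis unfolding Q(3) by simp
  qed
  show "linear_map_on A f"
    unfolding linear_map_on_def
  proof (intro conjI ballI allI)
    fix x y assume xy: "x \<in> A" "y \<in> A"
    have "(f x - x) + (f y - y) \<in> V"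
      by (intro fs.subspace_add[OF V] f(2) xy)
    then have "f x + f y - (x + y) \<in> V"
      by (simp only: add_diff_add[symmetric])
    then show "f (x + y) = f x + f y"
      by (intro uniq[symmetric] fs.subspace_add[OF Q(1)] fs.subspace_add[OF A] f(1) xy)
  next
    fix c x assume x: "x \<in> A"
    have "fscale c (f x - x) \<in> V"
      by (intro fs.subspace_scale[OF V] f(2) x)
    then have "fscale c (f x) - fscale c x \<in> V"
      by (simp only: fs.scale_right_diff_distrib)
    then show "f (fscale c x) = fscale c (f x)"
      by (intro uniq[symmetric] fs.subspace_scale[OF Q(1)] fs.subspace_scale[OF A] f(1) x)
  qed
  show "inj_on f A"
  proof (rule inj_onI)
    fix x y assume xy: "x \<in> A" "y \<in> A" "f x = f y"
    have "(f y - y) - (f x - x) \<in> V"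
      by (intro fs.subspace_diff[OF V] f(2) xy)
    then have "x - y \<in> V" using xy(3) by simp
    moreover have "x - y \<in> A" by (intro fs.subspace_diff[OF A] xy)
    ultimately have "x - y \<in> A \<inter> V" by simp
    then show "x = y" unfolding AV by simp
  qed
  show "f ` A = Q"
  proof (intro equalityI subsetI)
    fix x assume x: "x \<in> Q"
    with Q(2) obtain u v where uv: "x = u + v" "u \<in> A" "v \<in> V" unfolding P by blast
    then have "x = f u" using uniq[OF x, of u] by simp
    with uv show "x \<in> f ` A" by blast
  qed (use f(1) in auto)
  have "P = {u + v | u v. u \<in> Q \<and> v \<in> V}"
  proof (intro equalityI subsetI)
    fix x assume "x \<in> P"
    then obtain u v where uv: "x = u + v" "u \<in> A" "v \<in> V" unfolding P by blast
    then have "x = f u + (v - (f u - u))" "v - (f u - u) \<in> V"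
      by (simp, intro fs.subspace_diff[OF V] f(2))
    with uv f(1) show "x \<in> {u + v | u v. u \<in> Q \<and> v \<in> V}" by blast
  next
    fix x assume "x \<in> {u + v | u v. u \<in> Q \<and> v \<in> V}"
    then obtain q v where qv: "x = q + v" "q \<in> Q" "v \<in> V" by blast
    with Q(2) obtain u w where uw: "q = u + w" "u \<in> A" "w \<in> V" unfolding P by blast
    with qv have "x = u + (w + v)" "w + v \<in> V"
      by (simp add: add.assoc, intro fs.subspace_add[OF V])
    with uw show "x \<in> P" unfolding P by blast
  qed
  with Q V show "is_direct_sum P Q V" by (simp add: is_direct_sum_def)
qed

section \<open>Graded sums\<close>

lemma graded_sumI: "(\<And>k. k \<le> N \<Longrightarrow> g k \<in> W k) \<Longrightarrow> (\<Sum>k\<le>N. g k) \<in> graded_sum N W"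
  unfolding graded_sum_def by blast

lemma graded_sumE:
  assumes "f \<in> graded_sum N W"
  obtains g where "f = (\<Sum>k\<le>N. g k)" "\<And>k. k \<le> N \<Longrightarrow> g k \<in> W k"
  using assms unfolding graded_sum_def by auto

lemma subspace_graded_sum:
  fixes W :: "nat \<Rightarrow> ('a \<Rightarrow> 'k::field) set"
  assumes W: "\<And>k. k \<le> N \<Longrightarrow> fs.subspace (W k)"
  shows "fs.subspace (graded_sum N W)"
proof (rule fs.subspaceI)
  have "(\<Sum>k\<le>N. 0 :: 'a \<Rightarrow> 'k) \<in> graded_sum N W"
    using W by (intro graded_sumI fs.subspace_0)
  then show "0 \<in> graded_sum N W" by simp
next
  fix x y assume "x \<in> graded_sum N W" "y \<in> graded_sum N W"
  then obtain g h where "x = (\<Sum>k\<le>N. g k)" "\<And>k. k \<le> N \<Longrightarrow> g k \<in> W k"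
    "y = (\<Sum>k\<le>N. h k)" "\<And>k. k \<le> N \<Longrightarrow> h k \<in> W k"
    by (auto elim!: graded_sumE)
  with W show "x + y \<in> graded_sum N W"
    by (auto simp flip: sum.distrib intro!: graded_sumI fs.subspace_add)
next
  fix c x assume "x \<in> graded_sum N W"
  then obtain g where "x = (\<Sum>k\<le>N. g k)" "\<And>k. k \<le> N \<Longrightarrow> g k \<in> W k"
    by (auto elim!: graded_sumE)
  with W show "fscale c x \<in> graded_sum N W"
    by (auto simp: fs.scale_sum_right intro!: graded_sumI fs.subspace_scale)
qed

lemma summand_subset_graded_sum:
  fixes W :: "nat \<Rightarrow> ('a \<Rightarrow> 'k::field) set"
  assumes "\<And>k. k \<le> N \<Longrightarrow> fs.subspace (W k)" "m \<le> N"
  shows "W m \<subseteq> graded_sum N W"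
proof
  fix x assume "x \<in> W m"
  then have "(\<Sum>k\<le>N. if k = m then x else 0) \<in> graded_sum N W"
    using assms by (intro graded_sumI) (auto intro: fs.subspace_0)
  with assms(2) show "x \<in> graded_sum N W" by simp
qed

lemma graded_sum_span:
  fixes S :: "nat \<Rightarrow> ('a \<Rightarrow> 'k::field) set"
  shows "graded_sum N (\<lambda>k. fs.span (S k)) = fs.span (\<Union>k\<le>N. S k)"
proof
  have "fs.span (S k) \<subseteq> fs.span (\<Union>k\<le>N. S k)" if "k \<le> N" for k
    using that by (intro fs.span_mono) auto
  then show "graded_sum N (\<lambda>k. fs.span (S k)) \<subseteq> fs.span (\<Union>k\<le>N. S k)"
    by (auto elim!: graded_sumE intro!: fs.span_sum)
next
  show "fs.span (\<Union>k\<le>N. S k) \<subseteq> graded_sum N (\<lambda>k. fs.span (S k))"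
  proof (rule fs.span_minimal)
    show "(\<Union>k\<le>N. S k) \<subseteq> graded_sum N (\<lambda>k. fs.span (S k))"
      using summand_subset_graded_sum[of N "\<lambda>k. fs.span (S k)"] fs.span_superset
      by (fastforce simp: fs.subspace_span)
  qed (rule subspace_graded_sum, rule fs.subspace_span)
qed

lemma taylor_part_graded_sum:
  assumes "\<And>k. k \<le> N \<Longrightarrow> g k \<in> hom_polys a k"
  shows "taylor_part l a (\<Sum>k\<le>N. g k) = (if l \<le> N then g l else 0)"
proof -
  have "taylor_part l a (\<Sum>k\<le>N. g k) = (\<Sum>k\<le>N. taylor_part l a (g k))"
    using assms by (intro taylor_part_sum[OF open_UNIV UNIV_I] smooth_cont_diff_on smooth_hom_polys) auto
  also have "\<dots> = (\<Sum>k\<le>N. if l = k then g k else 0)"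
    using assms by (intro sum.cong refl) (simp add: taylor_part_hom_polys)
  also have "\<dots> = (if l \<le> N then g l else 0)"
    by (simp add: sum.delta)
  finally show ?thesis .
qed

text \<open>
  The Taylor parts recover the summands, so the decomposition described by \<open>components\<close> is unique.
  The spaces \<open>W k\<close> may be proper subspaces of the homogeneous pieces, as for the inputs of the algorithm.
\<close>

lemma components_graded_sum:
  fixes g :: "nat \<Rightarrow> real ^ 'd \<Rightarrow> 'k::real_normed_field"
  assumes W: "\<And>k. k \<le> N \<Longrightarrow> W k \<subseteq> hom_polys a k" and g: "\<And>k. k \<le> N \<Longrightarrow> g k \<in> W k"
  shows "components N W (\<Sum>k\<le>N. g k) = (\<lambda>k. if k \<le> N then g k else 0)"
  unfolding components_def
proof (rule the_equality)
  fix h assume h: "(\<forall>k\<le>N. h k \<in> W k) \<and> (\<forall>k>N. h k = 0) \<and> (\<Sum>k\<le>N. g k) = (\<Sum>k\<le>N. h k)"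
  show "h = (\<lambda>k. if k \<le> N then g k else 0)"
  proof
    fix l
    have "(if l \<le> N then g l else 0) = taylor_part l a (\<Sum>k\<le>N. g k)"
      by (rule taylor_part_graded_sum[symmetric]) (use W g in blast)
    also have "\<dots> = taylor_part l a (\<Sum>k\<le>N. h k)" using h by simp
    also have "\<dots> = (if l \<le> N then h l else 0)"
      by (rule taylor_part_graded_sum) (use W h in blast)
    finally show "h l = (if l \<le> N then g l else 0)" using h by (simp split: if_splits)
  qed
qed (use g in simp)

text \<open>
  Decompositions of the homogeneous pieces can be added up, because an element of both graded sums has
  the same Taylor parts in either representation.
\<close>

lemma is_direct_sum_graded_sum:
  fixes A B H :: "nat \<Rightarrow> (real ^ 'd \<Rightarrow> 'k::real_normed_field) set"
  assumes H: "\<And>k. k \<le> N \<Longrightarrow> H k \<subseteq> hom_polys a k"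
    and sum: "\<And>k. k \<le> N \<Longrightarrow> is_direct_sum (H k) (A k) (B k)"
  shows "is_direct_sum (graded_sum N H) (graded_sum N A) (graded_sum N B)"
proof -
  have A: "fs.subspace (A k)" and B: "fs.subspace (B k)" and AB: "A k \<inter> B k = {0}"
    and HAB: "H k = {u + v | u v. u \<in> A k \<and> v \<in> B k}" if "k \<le> N" for k
    using sum[OF that] unfolding is_direct_sum_def by simp_all
  have AH: "u \<in> H k" if "k \<le> N" "u \<in> A k" for k u
  proof -
    have "u + 0 \<in> H k" unfolding HAB[OF that(1)] using that(2) fs.subspace_0[OF B[OF that(1)]] by blast
    then show ?thesis by simp
  qed
  have BH: "v \<in> H k" if "k \<le> N" "v \<in> B k" for k v
  proof -
    have "0 + v \<in> H k" unfolding HAB[OF that(1)] using that(2) fs.subspace_0[OF A[OF that(1)]] by blast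
    then show ?thesis by simp
  qed
  have subA: "fs.subspace (graded_sum N A)" and subB: "fs.subspace (graded_sum N B)"
    using A B by (simp_all add: subspace_graded_sum)
  have "x = 0" if xA: "x \<in> graded_sum N A" and xB: "x \<in> graded_sum N B" for x
  proof -
    obtain f where f: "x = (\<Sum>k\<le>N. f k)" "\<And>k. k \<le> N \<Longrightarrow> f k \<in> A k"
      using xA by (rule graded_sumE) auto
    obtain g where g: "x = (\<Sum>k\<le>N. g k)" "\<And>k. k \<le> N \<Longrightarrow> g k \<in> B k"
      using xB by (rule graded_sumE) auto
    have "f k = 0" if k: "k \<le> N" for k
    proof -
      have "f k = taylor_part k a x"
        unfolding f(1) using taylor_part_graded_sum[of N f a k] f(2) AH H k by (simp add: subset_iff)
      also have "\<dots> = g k"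
        unfolding g(1) using taylor_part_graded_sum[of N g a k] g(2) BH H k by (simp add: subset_iff)
      finally have "f k \<in> A k \<inter> B k" using f(2)[OF k] g(2)[OF k] by simp
      then show ?thesis unfolding AB[OF k] by simp
    qed
    then show ?thesis unfolding f(1) by simp
  qed
  then have "graded_sum N A \<inter> graded_sum N B = {0}"
    using fs.subspace_0[OF subA] fs.subspace_0[OF subB] by auto
  moreover have "graded_sum N H = {u + v | u v. u \<in> graded_sum N A \<and> v \<in> graded_sum N B}"
  proof (intro equalityI subsetI)
    fix x assume "x \<in> graded_sum N H"
    then obtain h where h: "x = (\<Sum>k\<le>N. h k)" "\<And>k. k \<le> N \<Longrightarrow> h k \<in> H k"
      by (rule graded_sumE) auto
    have "\<forall>k. \<exists>u v. k \<le> N \<longrightarrow> h k = u + v \<and> u \<in> A k \<and> v \<in> B k"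
      using h(2) HAB by fastforce
    then obtain u v where uv: "\<And>k. k \<le> N \<Longrightarrow> h k = u k + v k \<and> u k \<in> A k \<and> v k \<in> B k"
      by metis
    then have "x = (\<Sum>k\<le>N. u k) + (\<Sum>k\<le>N. v k)"
      unfolding h(1) sum.distrib[symmetric] by (intro sum.cong refl) simp
    moreover have "(\<Sum>k\<le>N. u k) \<in> graded_sum N A" "(\<Sum>k\<le>N. v k) \<in> graded_sum N B"
      using uv by (auto intro!: graded_sumI)
    ultimately show "x \<in> {u + v | u v. u \<in> graded_sum N A \<and> v \<in> graded_sum N B}" by blast
  next
    fix x assume "x \<in> {u + v | u v. u \<in> graded_sum N A \<and> v \<in> graded_sum N B}"
    then obtain y z where x: "x = y + z" and y: "y \<in> graded_sum N A" and z: "z \<in> graded_sum N B"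
      by blast
    obtain f where f: "y = (\<Sum>k\<le>N. f k)" "\<And>k. k \<le> N \<Longrightarrow> f k \<in> A k"
      using y by (rule graded_sumE) auto
    obtain g where g: "z = (\<Sum>k\<le>N. g k)" "\<And>k. k \<le> N \<Longrightarrow> g k \<in> B k"
      using z by (rule graded_sumE) auto
    have "x = (\<Sum>k\<le>N. f k + g k)" unfolding x f(1) g(1) by (simp add: sum.distrib)
    moreover have "f k + g k \<in> H k" if "k \<le> N" for k
      unfolding HAB[OF that] using f(2)[OF that] g(2)[OF that] by blast
    ultimately show "x \<in> graded_sum N H" by (auto intro!: graded_sumI)
  qed
  ultimately show ?thesis
    using subA subB by (simp add: is_direct_sum_def)
qed

section \<open>Independence of the polynomial spaces from the centre\<close>

lemma mult_coordinate_span: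
  assumes "f \<in> fs.span (\<Union>m\<le>p. shifted_monom b ` multi_indices m)"
  shows "(\<lambda>x. of_real (x $ i - b $ i) * f x) \<in> fs.span (\<Union>m\<le>Suc p. shifted_monom b ` multi_indices m)"
  using assms
proof (induction rule: fs.span_induct_alt)
  case base
  then show ?case using fs.span_zero by (simp add: zero_fun_def)
next
  case (step c f g)
  then obtain j m where f: "f = shifted_monom b j" and j: "(\<Sum>k\<in>UNIV. j k) = m" "m \<le> p"
    by (auto simp: multi_indices_def)
  have upd: "(\<lambda>x. of_real (x $ i - b $ i) * f x) = shifted_monom b (j(i := Suc (j i)))"
    unfolding f fun_eq_iff by (simp add: shifted_monom_remove[of b _ _ i] mult.assoc)
  have "sum (j(i := Suc (j i))) UNIV = Suc m"
    using sum_decrement[of "j(i := Suc (j i))" i] j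
    by (simp add: sum.remove[of UNIV i])
  then have "shifted_monom b (j(i := Suc (j i))) \<in> fs.span (\<Union>m\<le>Suc p. shifted_monom b ` multi_indices m)"
    using j(2) by (intro fs.span_base) (auto simp: multi_indices_def)
  then have "fscale c (\<lambda>x. of_real (x $ i - b $ i) * f x) + (\<lambda>x. of_real (x $ i - b $ i) * g x)
      \<in> fs.span (\<Union>m\<le>Suc p. shifted_monom b ` multi_indices m)"
    unfolding upd using step.IH by (intro fs.span_add fs.span_scale)
  moreover have "(\<lambda>x. of_real (x $ i - b $ i) * (fscale c f + g) x) =
      fscale c (\<lambda>x. of_real (x $ i - b $ i) * f x) + (\<lambda>x. of_real (x $ i - b $ i) * g x)"
    by (simp add: fun_eq_iff fun_apply algebra_simps)
  ultimately show ?case by simp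
qed

text \<open>
  Split off one linear factor and write it as \<open>x\<^sub>i - a\<^sub>i = (x\<^sub>i - b\<^sub>i) + (b\<^sub>i - a\<^sub>i)\<close>.
\<close>

lemma shifted_monom_in_span_other_center:
  "j \<in> multi_indices n \<Longrightarrow> shifted_monom a j \<in> fs.span (\<Union>m\<le>n. shifted_monom b ` multi_indices m)"
proof (induction n arbitrary: j)
  case 0
  then have "shifted_monom a j = shifted_monom b j"
    by (simp add: multi_indices_def shifted_monom_def)
  with 0 show ?case by (auto intro: fs.span_base)
next
  case (Suc n)
  then have "(\<Sum>k\<in>UNIV. j k) \<noteq> 0" by (simp add: multi_indices_def)
  then obtain i where i: "j i \<noteq> 0" by (meson sum.neutral)
  define q :: "real ^ 'a \<Rightarrow> 'b" where "q = shifted_monom a (j(i := j i - 1))"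
  have "j(i := j i - 1) \<in> multi_indices n"
    using sum_decrement[of j i] i Suc.prems by (simp add: multi_indices_def)
  then have q: "q \<in> fs.span (\<Union>m\<le>n. shifted_monom b ` multi_indices m)"
    unfolding q_def by (rule Suc.IH)
  moreover have "(\<Union>m\<le>n. shifted_monom b ` multi_indices m) \<subseteq>
      (\<Union>m\<le>Suc n. shifted_monom b ` multi_indices m :: (real ^ 'a \<Rightarrow> 'b) set)"
    by (intro UN_mono) auto
  ultimately have q': "q \<in> fs.span (\<Union>m\<le>Suc n. shifted_monom b ` multi_indices m)"
    using fs.span_mono by blast
  obtain m where m: "j i = Suc m" using i by (cases "j i") auto
  have "shifted_monom a j = (\<lambda>x. of_real (x $ i - a $ i) * q x)"
    unfolding q_def fun_eq_iff by (simp add: shifted_monom_remove[of a _ _ i] m mult.assoc)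
  also have "\<dots> = (\<lambda>x. of_real (x $ i - b $ i) * q x) + fscale (of_real (b $ i - a $ i)) q"
    by (simp add: fun_eq_iff fun_apply algebra_simps)
  finally show ?case
    using mult_coordinate_span[OF q] q' by (simp add: fs.span_add fs.span_scale)
qed

text \<open>
  Both sides are spanned by monomials of degree at most \<open>p\<close>, on the left about \<open>0\<close> and on the right
  about \<open>a\<close>.
\<close>

lemma polys_eq_graded_sum: "polys p = graded_sum p (hom_polys a)"
proof -
  have sub: "fs.span (\<Union>m\<le>p. shifted_monom a ` multi_indices m) \<subseteq>
      fs.span (\<Union>m\<le>p. shifted_monom b ` multi_indices m :: (real ^ 'a \<Rightarrow> 'b) set)" for a b
  proof (intro fs.span_minimal fs.subspace_span subsetI)
    fix f :: "real ^ 'a \<Rightarrow> 'b" assume "f \<in> (\<Union>m\<le>p. shifted_monom a ` multi_indices m)"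
    then obtain m j where "m \<le> p" "j \<in> multi_indices m" "f = shifted_monom a j" by auto
    with shifted_monom_in_span_other_center[of j m a b]
      fs.span_mono[of "\<Union>k\<le>m. shifted_monom b ` multi_indices k" "\<Union>k\<le>p. shifted_monom b ` multi_indices k"]
    show "f \<in> fs.span (\<Union>m\<le>p. shifted_monom b ` multi_indices m)" by fastforce
  qed
  show ?thesis
    unfolding polys_def hom_polys_def graded_sum_span using sub by blast
qed

section \<open>The differential operator on graded polynomials\<close>

lemma smooth_polys: "f \<in> polys p \<Longrightarrow> smooth f"
  unfolding polys_eq_graded_sum[of p 0]
  by (elim graded_sumE) (auto intro!: smooth_sum dest: smooth_hom_polys)

lemma subspace_polys: "fs.subspace (polys p)"
  unfolding polys_def by (rule fs.subspace_span)

lemma taylor_part_taylor: "l \<le> k \<Longrightarrow> taylor_part l a (taylor k a f) = taylor_part l a f"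
  unfolding taylor_eq_sum by (subst taylor_part_graded_sum) (auto simp: taylor_part_in_hom_polys)

lemma taylor_eq_0_iff: "taylor k a f = 0 \<longleftrightarrow> (\<forall>l\<le>k. taylor_part l a f = 0)"
  using taylor_part_taylor[of _ k a f] by (auto simp: taylor_eq_sum)

lemma multi_deriv_hom_polys:
  assumes "f \<in> hom_polys a n" "j \<in> multi_indices m"
  shows "multi_deriv j f \<in> hom_polys a (n - m)" and "n < m \<Longrightarrow> multi_deriv j f = 0"
  using iterated_partial_hom_polys[OF assms(1), of "deriv_word j"]
    iterated_partial_hom_polys_eq_0[OF assms(1), of "deriv_word j"]
  by (simp_all add: multi_deriv_eq_iterated_partial length_deriv_word_multi_indices[OF assms(2)])

lemma multi_deriv_add:
  "smooth f \<Longrightarrow> smooth g \<Longrightarrow> multi_deriv j (f + g) = multi_deriv j f + multi_deriv j g"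
  by (simp add: multi_deriv_eq_iterated_partial iterated_partial_smooth_add)

lemma multi_deriv_fscale: "smooth f \<Longrightarrow> multi_deriv j (fscale b f) = fscale b (multi_deriv j f)"
  by (simp add: multi_deriv_eq_iterated_partial iterated_partial_smooth_fscale)

lemma smooth_multi_deriv: "smooth f \<Longrightarrow> smooth (multi_deriv j f)"
  by (simp add: multi_deriv_eq_iterated_partial smooth_iterated_partial)

lemma frozen_op_eq_sum: "frozen_op \<gamma> c a f = (\<Sum>j\<in>multi_indices \<gamma>. fscale (c j a) (multi_deriv j f))"
  by (simp add: fun_eq_iff frozen_op_def sum_apply fscale_apply)

lemma frozen_op_hom_polys:
  assumes "f \<in> hom_polys a n"
  shows "frozen_op \<gamma> c a f \<in> hom_polys a (n - \<gamma>)" and "n < \<gamma> \<Longrightarrow> frozen_op \<gamma> c a f = 0"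
  unfolding frozen_op_eq_sum
  by (intro fs.subspace_sum fs.subspace_scale subspace_hom_polys multi_deriv_hom_polys assms)
    (auto simp: multi_deriv_hom_polys(2)[OF assms] intro!: sum.neutral)

lemma frozen_op_add:
  "smooth f \<Longrightarrow> smooth g \<Longrightarrow> frozen_op \<gamma> c a (f + g) = frozen_op \<gamma> c a f + frozen_op \<gamma> c a g"
  by (simp add: frozen_op_eq_sum multi_deriv_add fs.scale_right_distrib sum.distrib)

lemma frozen_op_fscale: "smooth f \<Longrightarrow> frozen_op \<gamma> c a (fscale b f) = fscale b (frozen_op \<gamma> c a f)"
  by (simp add: frozen_op_eq_sum multi_deriv_fscale fs.scale_sum_right mult.commute)

lemma frozen_op_zero [simp]: "frozen_op \<gamma> c a 0 = 0"
  using frozen_op_fscale[OF smooth_zero, of \<gamma> c a 0] by simp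

lemma frozen_op_diff:
  assumes "smooth f" "smooth g"
  shows "frozen_op \<gamma> c a (f - g) = frozen_op \<gamma> c a f - frozen_op \<gamma> c a g"
proof -
  have "f - g = f + fscale (-1) g" by simp
  then show ?thesis using assms by (simp only: frozen_op_add frozen_op_fscale smooth_fscale) simp
qed

lemma frozen_op_sum:
  "(\<And>b. b \<in> B \<Longrightarrow> smooth (f b)) \<Longrightarrow> frozen_op \<gamma> c a (\<Sum>b\<in>B. f b) = (\<Sum>b\<in>B. frozen_op \<gamma> c a (f b))"
  by (induction B rule: infinite_finite_induct) (auto simp: frozen_op_add smooth_sum)

lemma diff_op_eq_sum:
  "diff_op \<gamma> c f = (\<Sum>m\<le>\<gamma>. \<Sum>j\<in>multi_indices m. (\<lambda>x. c j x * multi_deriv j f x))"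
  by (simp add: fun_eq_iff diff_op_def sum_apply)

lemma diff_op_add: "smooth f \<Longrightarrow> smooth g \<Longrightarrow> diff_op \<gamma> c (f + g) = diff_op \<gamma> c f + diff_op \<gamma> c g"
  by (simp add: fun_eq_iff diff_op_def multi_deriv_add fun_apply distrib_left sum.distrib)

lemma diff_op_fscale: "smooth f \<Longrightarrow> diff_op \<gamma> c (fscale b f) = fscale b (diff_op \<gamma> c f)"
  by (simp add: fun_eq_iff diff_op_def multi_deriv_fscale fun_apply sum_distrib_left mult.left_commute)

lemma diff_op_zero [simp]: "diff_op \<gamma> c 0 = 0"
  using diff_op_fscale[OF smooth_zero, of \<gamma> c 0] by simp

locale regular_operator =
  fixes \<gamma> p :: nat and x0 :: "real ^ 'd"
    and c :: "('d \<Rightarrow> nat) \<Rightarrow> real ^ 'd \<Rightarrow> 'k::real_normed_field"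
  assumes order_less: "\<gamma> < p"
    and coeff: "\<And>m j. m \<le> \<gamma> \<Longrightarrow> j \<in> multi_indices m \<Longrightarrow> cont_diff_near (p - \<gamma>) x0 (c j)"
begin

text \<open>
  The coefficients are regular each on a neighbourhood of its own; as there are finitely many, these
  can be intersected.
\<close>

lemma common_neighbourhood:
  obtains S where "open S" "x0 \<in> S"
    "\<And>m j. m \<le> \<gamma> \<Longrightarrow> j \<in> multi_indices m \<Longrightarrow> cont_diff_on (p - \<gamma>) S (c j)"
proof -
  define J where "J = (\<Union>m\<le>\<gamma>. multi_indices m :: ('d \<Rightarrow> nat) set)"
  have "\<forall>j\<in>J. \<exists>S. open S \<and> x0 \<in> S \<and> cont_diff_on (p - \<gamma>) S (c j)"
    using coeff by (auto simp: J_def cont_diff_near_def)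
  then obtain S where S: "\<forall>j\<in>J. open (S j) \<and> x0 \<in> S j \<and> cont_diff_on (p - \<gamma>) (S j) (c j)"
    by metis
  have "finite J" by (simp add: J_def finite_multi_indices)
  with S have "open (\<Inter>j\<in>J. S j)" "x0 \<in> (\<Inter>j\<in>J. S j)" by auto
  moreover have "cont_diff_on (p - \<gamma>) (\<Inter>j\<in>J. S j) (c j)" if "m \<le> \<gamma>" "j \<in> multi_indices m" for m j
  proof -
    have "j \<in> J" using that by (auto simp: J_def)
    with S show ?thesis by (blast intro: cont_diff_on_subset)
  qed
  ultimately show ?thesis by (rule that)
qed

lemma cont_diff_on_diff_op:
  obtains S where "open S" "x0 \<in> S"
    "\<And>f l. smooth f \<Longrightarrow> l \<le> p - \<gamma> \<Longrightarrow> cont_diff_on l S (diff_op \<gamma> c f)"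
proof -
  obtain S where S: "open S" "x0 \<in> S"
    and c: "\<And>m j. m \<le> \<gamma> \<Longrightarrow> j \<in> multi_indices m \<Longrightarrow> cont_diff_on (p - \<gamma>) S (c j)"
    by (rule common_neighbourhood) auto
  have "cont_diff_on (p - \<gamma>) S (diff_op \<gamma> c f)" if "smooth f" for f
    unfolding diff_op_eq_sum using c smooth_cont_diff_on[OF smooth_multi_deriv[OF that]]
    by (intro cont_diff_on_sum cont_diff_on_mult S(1)) auto
  with S show ?thesis by (blast intro: that cont_diff_on_le)
qed

lemma taylor_part_diff_op_add:
  assumes "smooth f" "smooth g" "l \<le> p - \<gamma>"
  shows "taylor_part l x0 (diff_op \<gamma> c (f + g)) =
    taylor_part l x0 (diff_op \<gamma> c f) + taylor_part l x0 (diff_op \<gamma> c g)"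
proof -
  obtain S where S: "open S" "x0 \<in> S"
    and L: "\<And>f l. smooth f \<Longrightarrow> l \<le> p - \<gamma> \<Longrightarrow> cont_diff_on l S (diff_op \<gamma> c f)"
    by (rule cont_diff_on_diff_op) auto
  show ?thesis
    using assms by (simp add: diff_op_add taylor_part_add[OF S] L)
qed

lemma taylor_part_diff_op_fscale:
  assumes "smooth f" "l \<le> p - \<gamma>"
  shows "taylor_part l x0 (diff_op \<gamma> c (fscale b f)) = fscale b (taylor_part l x0 (diff_op \<gamma> c f))"
proof -
  obtain S where S: "open S" "x0 \<in> S"
    and L: "\<And>f l. smooth f \<Longrightarrow> l \<le> p - \<gamma> \<Longrightarrow> cont_diff_on l S (diff_op \<gamma> c f)"
    by (rule cont_diff_on_diff_op) auto
  show ?thesis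
    using assms by (simp add: diff_op_fscale taylor_part_fscale[OF S] L)
qed

lemma taylor_part_diff_op_sum:
  assumes "l \<le> p - \<gamma>"
  shows "(\<And>b. b \<in> B \<Longrightarrow> smooth (f b)) \<Longrightarrow>
    taylor_part l x0 (diff_op \<gamma> c (\<Sum>b\<in>B. f b)) = (\<Sum>b\<in>B. taylor_part l x0 (diff_op \<gamma> c (f b)))"
  using assms
  by (induction B rule: infinite_finite_induct) (auto simp: taylor_part_diff_op_add smooth_sum)

text \<open>
  The term with a derivative of order \<open>m \<le> \<gamma>\<close> is a coefficient times a homogeneous polynomial of
  degree \<open>n - m \<ge> n - \<gamma> \<ge> l\<close>. It contributes in degree \<open>l\<close> only if \<open>n - m = l\<close>, which forces
  \<open>m = \<gamma>\<close> and \<open>n = l + \<gamma>\<close>.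
\<close>

lemma taylor_part_diff_op_hom_polys:
  assumes f: "f \<in> hom_polys x0 n" and l: "l \<le> p - \<gamma>" "l + \<gamma> \<le> n"
  shows "taylor_part l x0 (diff_op \<gamma> c f) = (if l + \<gamma> = n then frozen_op \<gamma> c x0 f else 0)"
proof -
  obtain S where S: "open S" "x0 \<in> S"
    and c: "\<And>m j. m \<le> \<gamma> \<Longrightarrow> j \<in> multi_indices m \<Longrightarrow> cont_diff_on (p - \<gamma>) S (c j)"
    by (rule common_neighbourhood) auto
  have c_l: "cont_diff_on l S (c j)" if "m \<le> \<gamma>" "j \<in> multi_indices m" for m j
    using c[OF that] l(1) by (rule cont_diff_on_le)
  have smooth_D: "smooth (multi_deriv j f)" for j
    by (intro smooth_multi_deriv smooth_hom_polys[OF f])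
  have prod: "cont_diff_on l S (\<lambda>x. c j x * multi_deriv j f x)" if "m \<le> \<gamma>" "j \<in> multi_indices m" for m j
    by (intro cont_diff_on_mult S(1) c_l[OF that] smooth_cont_diff_on smooth_D)
  have part: "taylor_part l x0 (\<lambda>x. c j x * multi_deriv j f x) =
      (if m = \<gamma> then if l + \<gamma> = n then fscale (c j x0) (multi_deriv j f) else 0 else 0)"
    if m: "m \<le> \<gamma>" "j \<in> multi_indices m" for m j
  proof -
    have "taylor_part l x0 (\<lambda>x. c j x * multi_deriv j f x) =
        (if l = n - m then fscale (c j x0) (multi_deriv j f) else 0)"
      using l(2) m(1)
      by (intro taylor_part_mult_hom_poly[OF S c_l[OF m] multi_deriv_hom_polys(1)[OF f m(2)]]) simp
    moreover have "l = n - m \<longleftrightarrow> m = \<gamma> \<and> l + \<gamma> = n"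
      using l(2) m(1) by auto
    ultimately show ?thesis by simp
  qed
  have "taylor_part l x0 (diff_op \<gamma> c f) =
      (\<Sum>m\<le>\<gamma>. \<Sum>j\<in>multi_indices m. taylor_part l x0 (\<lambda>x. c j x * multi_deriv j f x))"
    unfolding diff_op_eq_sum using prod
    by (subst taylor_part_sum[OF S]) (auto intro!: sum.cong taylor_part_sum[OF S] cont_diff_on_sum[OF S(1)])
  also have "\<dots> = (\<Sum>m\<le>\<gamma>. \<Sum>j\<in>multi_indices m.
      if m = \<gamma> then if l + \<gamma> = n then fscale (c j x0) (multi_deriv j f) else 0 else 0)"
    by (intro sum.cong refl part) auto
  also have "\<dots> = (\<Sum>m\<le>\<gamma>. if m = \<gamma> then if l + \<gamma> = n then frozen_op \<gamma> c x0 f else 0 else 0)"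
    by (intro sum.cong refl) (simp add: frozen_op_eq_sum)
  also have "\<dots> = (if l + \<gamma> = n then frozen_op \<gamma> c x0 f else 0)"
    by simp
  finally show ?thesis .
qed

lemma rem_op_eq_sum:
  assumes f: "f \<in> hom_polys x0 n" and n: "n \<le> p"
  shows "rem_op p \<gamma> c x0 f =
    (\<Sum>l\<le>p - \<gamma>. taylor_part l x0 (diff_op \<gamma> c f) - (if n = l + \<gamma> then frozen_op \<gamma> c x0 f else 0))"
proof -
  have "(\<Sum>l\<le>p - \<gamma>. if n = l + \<gamma> then frozen_op \<gamma> c x0 f else 0) = frozen_op \<gamma> c x0 f"
  \<comment> \<open>For \<open>n < \<gamma>\<close> no index matches, but then the constant-coefficient operator annihilates \<open>f\<close>.\<close>
  proof (cases "n < \<gamma>")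
    case True
    then show ?thesis by (simp add: frozen_op_hom_polys(2)[OF f])
  next
    case False
    then have "(\<Sum>l\<le>p - \<gamma>. if n = l + \<gamma> then frozen_op \<gamma> c x0 f else 0) =
        (\<Sum>l\<le>p - \<gamma>. if l = n - \<gamma> then frozen_op \<gamma> c x0 f else 0)"
      by (intro sum.cong refl) auto
    also have "\<dots> = frozen_op \<gamma> c x0 f" using n by simp
    finally show ?thesis .
  qed
  then show ?thesis
    unfolding rem_op_def taylor_eq_sum sum_subtractf by simp
qed

text \<open>
  The constant-coefficient operator maps degree \<open>n\<close> to degree \<open>n - \<gamma>\<close>, so only one block of the
  remainder differs from the Taylor part of the full operator.
\<close>

lemma rem_block_eq:
  assumes f: "f \<in> hom_polys x0 n" and n: "n \<le> p" and l: "l \<le> p - \<gamma>"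
  shows "rem_block p \<gamma> c x0 l f =
    taylor_part l x0 (diff_op \<gamma> c f) - (if n = l + \<gamma> then frozen_op \<gamma> c x0 f else 0)"
  unfolding rem_block_def rem_op_eq_sum[OF f n]
  using l f frozen_op_hom_polys(1)[OF f, of \<gamma> c]
  by (subst components_graded_sum[where a = x0])
    (auto intro!: fs.subspace_diff subspace_hom_polys taylor_part_in_hom_polys fs.subspace_0)

lemma rem_block_in_hom_polys:
  assumes "f \<in> hom_polys x0 n" "n \<le> p" "l \<le> p - \<gamma>"
  shows "rem_block p \<gamma> c x0 l f \<in> hom_polys x0 l"
  unfolding rem_block_eq[OF assms] using frozen_op_hom_polys(1)[OF assms(1), of \<gamma> c]
  by (auto intro!: fs.subspace_diff subspace_hom_polys taylor_part_in_hom_polys fs.subspace_0)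

lemma rem_op_eq_sum_rem_block:
  assumes "f \<in> hom_polys x0 n" "n \<le> p"
  shows "rem_op p \<gamma> c x0 f = (\<Sum>l\<le>p - \<gamma>. rem_block p \<gamma> c x0 l f)"
  unfolding rem_op_eq_sum[OF assms] by (intro sum.cong refl) (simp add: rem_block_eq[OF assms])

lemma rem_block_eq_0:
  assumes "f \<in> hom_polys x0 n" "n \<le> p" "l + \<gamma> \<le> n"
  shows "rem_block p \<gamma> c x0 l f = 0"
proof -
  have l: "l \<le> p - \<gamma>" using assms by simp
  show ?thesis
    using taylor_part_diff_op_hom_polys[OF assms(1) l assms(3)] by (simp add: rem_block_eq[OF assms(1,2) l])
qed

lemma rem_block_zero: "l \<le> p - \<gamma> \<Longrightarrow> rem_block p \<gamma> c x0 l 0 = 0"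
  using rem_block_eq[of 0 0 l] by (simp add: fs.subspace_0[OF subspace_hom_polys])

lemma taylor_part_diff_op_graded_sum:
  assumes g: "\<And>k. k \<le> p \<Longrightarrow> g k \<in> hom_polys x0 k" and l: "l \<le> p - \<gamma>"
  shows "taylor_part l x0 (diff_op \<gamma> c (\<Sum>k\<le>p. g k)) =
    frozen_op \<gamma> c x0 (g (l + \<gamma>)) + (\<Sum>j<l + \<gamma>. rem_block p \<gamma> c x0 l (g j))"
proof -
  have lp: "l + \<gamma> \<le> p" using l order_less by simp
  have "taylor_part l x0 (diff_op \<gamma> c (\<Sum>k\<le>p. g k)) = (\<Sum>k\<le>p. taylor_part l x0 (diff_op \<gamma> c (g k)))"
    using g by (intro taylor_part_diff_op_sum[OF l] smooth_hom_polys) auto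
  also have "\<dots> = (\<Sum>k\<le>p. (if k = l + \<gamma> then frozen_op \<gamma> c x0 (g k) else 0) + rem_block p \<gamma> c x0 l (g k))"
    using rem_block_eq[OF g _ l] by (intro sum.cong refl) simp
  also have "\<dots> = frozen_op \<gamma> c x0 (g (l + \<gamma>)) + (\<Sum>k\<le>p. rem_block p \<gamma> c x0 l (g k))"
    using lp by (simp add: sum.distrib)
  also have "(\<Sum>k\<le>p. rem_block p \<gamma> c x0 l (g k)) = (\<Sum>j<l + \<gamma>. rem_block p \<gamma> c x0 l (g j))"
    using lp rem_block_eq_0[OF g] by (intro sum.mono_neutral_right) auto
  finally show ?thesis .
qed

text \<open>
  The block-triangular system of equations behind the algorithm: the equation of index \<open>k\<close>, obtained
  from the Taylor part of degree \<open>k - \<gamma>\<close>, contains \<open>g k\<close> only through the constant-coefficient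
  operator and otherwise components of lower degree.
\<close>

lemma quasi_Trefftz_graded_sum_iff:
  assumes g: "\<And>k. k \<le> p \<Longrightarrow> g k \<in> hom_polys x0 k"
  shows "(\<Sum>k\<le>p. g k) \<in> quasi_Trefftz p \<gamma> c x0 \<longleftrightarrow>
    (\<forall>k\<in>{\<gamma>..p}. frozen_op \<gamma> c x0 (g k) + (\<Sum>j<k. rem_block p \<gamma> c x0 (k - \<gamma>) (g j)) = 0)"
proof -
  have "(\<Sum>k\<le>p. g k) \<in> polys p"
    unfolding polys_eq_graded_sum[of p x0] using g by (rule graded_sumI)
  then have "(\<Sum>k\<le>p. g k) \<in> quasi_Trefftz p \<gamma> c x0 \<longleftrightarrow>
      (\<forall>l\<le>p - \<gamma>. frozen_op \<gamma> c x0 (g (l + \<gamma>)) + (\<Sum>j<l + \<gamma>. rem_block p \<gamma> c x0 l (g j)) = 0)"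
    unfolding quasi_Trefftz_def taylor_eq_0_iff
    using taylor_part_diff_op_graded_sum[OF g] by simp
  also have "\<dots> \<longleftrightarrow>
      (\<forall>k\<in>{\<gamma>..p}. frozen_op \<gamma> c x0 (g k) + (\<Sum>j<k. rem_block p \<gamma> c x0 (k - \<gamma>) (g j)) = 0)"
    (is "(\<forall>l\<le>_. ?E (l + \<gamma>) l) \<longleftrightarrow> _")
  proof safe
    fix k assume "\<forall>l\<le>p - \<gamma>. ?E (l + \<gamma>) l" "k \<in> {\<gamma>..p}"
    then show "?E k (k - \<gamma>)" by (auto dest: spec[of _ "k - \<gamma>"])
  next
    fix l assume *: "\<forall>k\<in>{\<gamma>..p}. ?E k (k - \<gamma>)" and "l \<le> p - \<gamma>"
    with order_less have "l + \<gamma> \<in> {\<gamma>..p}" by simp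
    with * have "?E (l + \<gamma>) (l + \<gamma> - \<gamma>)" by blast
    then show "?E (l + \<gamma>) l" by simp
  qed
  finally show ?thesis .
qed

lemma subspace_quasi_Trefftz: "fs.subspace (quasi_Trefftz p \<gamma> c x0)"
proof (rule fs.subspaceI)
  show "0 \<in> quasi_Trefftz p \<gamma> c x0"
    unfolding quasi_Trefftz_def taylor_eq_0_iff by (simp add: fs.subspace_0[OF subspace_polys])
next
  fix f g assume "f \<in> quasi_Trefftz p \<gamma> c x0" "g \<in> quasi_Trefftz p \<gamma> c x0"
  then show "f + g \<in> quasi_Trefftz p \<gamma> c x0"
    using smooth_polys[of f p] smooth_polys[of g p] unfolding quasi_Trefftz_def taylor_eq_0_iff
    by (simp add: taylor_part_diff_op_add fs.subspace_add[OF subspace_polys])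
next
  fix b f assume "f \<in> quasi_Trefftz p \<gamma> c x0"
  then show "fscale b f \<in> quasi_Trefftz p \<gamma> c x0"
    using smooth_polys[of f p] unfolding quasi_Trefftz_def taylor_eq_0_iff
    by (simp add: taylor_part_diff_op_fscale fs.subspace_scale[OF subspace_polys])
qed

end

section \<open>The algorithm as a projection\<close>

locale quasi_Trefftz_algorithm = regular_operator \<gamma> p x0 c
  for \<gamma> p :: nat and x0 :: "real ^ 'd"
    and c :: "('d \<Rightarrow> nat) \<Rightarrow> real ^ 'd \<Rightarrow> 'k::real_normed_field" +
  fixes U V :: "nat \<Rightarrow> (real ^ 'd \<Rightarrow> 'k) set"
  assumes decomposition: "\<And>n. n \<in> {\<gamma>..p} \<Longrightarrow> is_direct_sum (hom_polys x0 n) (U n) (V n)"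
    and frozen_op_bij: "\<And>n. n \<in> {\<gamma>..p} \<Longrightarrow> bij_betw (frozen_op \<gamma> c x0) (V n) (hom_polys x0 (n - \<gamma>))"
begin

text \<open>
  In degrees below \<open>\<gamma>\<close> the input is unrestricted, so there its complement is trivial.
\<close>

definition complement_summand :: "nat \<Rightarrow> (real ^ 'd \<Rightarrow> 'k) set" where
  "complement_summand k = (if k < \<gamma> then {0} else V k)"

definition complement :: "(real ^ 'd \<Rightarrow> 'k) set" where
  "complement = graded_sum p complement_summand"

lemma summand_decomposition:
  assumes "k \<le> p"
  shows "is_direct_sum (hom_polys x0 k) (input_summand \<gamma> x0 U k) (complement_summand k)"
proof (cases "k < \<gamma>")
  case True
  then show ?thesis
    by (auto simp: is_direct_sum_def input_summand_def complement_summand_def subspace_hom_polys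
        fs.subspace_0 fs.subspace_single_0)
next
  case False
  with assms show ?thesis
    using decomposition[of k] by (simp add: input_summand_def complement_summand_def)
qed

lemma input_summand_subset: "k \<le> p \<Longrightarrow> input_summand \<gamma> x0 U k \<subseteq> hom_polys x0 k"
  and complement_summand_subset: "k \<le> p \<Longrightarrow> complement_summand k \<subseteq> hom_polys x0 k"
  and subspace_complement_summand: "k \<le> p \<Longrightarrow> fs.subspace (complement_summand k)"
proof -
  assume "k \<le> p"
  from summand_decomposition[OF this]
  have A: "fs.subspace (input_summand \<gamma> x0 U k)" and B: "fs.subspace (complement_summand k)"
    and H: "hom_polys x0 k = {u + v | u v. u \<in> input_summand \<gamma> x0 U k \<and> v \<in> complement_summand k}"
    by (simp_all add: is_direct_sum_def)
  show "fs.subspace (complement_summand k)" by (rule B)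
  show "input_summand \<gamma> x0 U k \<subseteq> hom_polys x0 k"
  proof
    fix u assume "u \<in> input_summand \<gamma> x0 U k"
    with fs.subspace_0[OF B] have "u + 0 \<in> hom_polys x0 k" unfolding H by blast
    then show "u \<in> hom_polys x0 k" by simp
  qed
  show "complement_summand k \<subseteq> hom_polys x0 k"
  proof
    fix v assume "v \<in> complement_summand k"
    with fs.subspace_0[OF A] have "0 + v \<in> hom_polys x0 k" unfolding H by blast
    then show "v \<in> hom_polys x0 k" by simp
  qed
qed

lemma polys_decomposition: "is_direct_sum (polys p) (input_space p \<gamma> x0 U) complement"
  unfolding polys_eq_graded_sum[of p x0] input_space_def complement_def
  by (rule is_direct_sum_graded_sum[OF subset_refl summand_decomposition])

lemma V_in_hom_polys: "k \<in> {\<gamma>..p} \<Longrightarrow> v \<in> V k \<Longrightarrow> v \<in> hom_polys x0 k"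
  using complement_summand_subset[of k] by (auto simp: complement_summand_def)

lemma zero_in_V: "k \<in> {\<gamma>..p} \<Longrightarrow> 0 \<in> V k"
  using fs.subspace_0[OF subspace_complement_summand[of k]] by (simp add: complement_summand_def)

lemma frozen_op_eq_0_imp:
  assumes "k \<in> {\<gamma>..p}" "v \<in> V k" "frozen_op \<gamma> c x0 v = 0"
  shows "v = 0"
proof -
  have "inj_on (frozen_op \<gamma> c x0) (V k)"
    using frozen_op_bij[OF assms(1)] by (rule bij_betw_imp_inj_on)
  then show ?thesis
    by (rule inj_onD) (simp_all add: assms(2,3) zero_in_V[OF assms(1)])
qed

text \<open>
  By induction on the degree: once all lower components vanish, the equation of index \<open>k\<close> says that
  the constant-coefficient operator kills the component in \<open>V k\<close>, on which it is injective.
\<close>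

lemma quasi_Trefftz_Int_complement: "quasi_Trefftz p \<gamma> c x0 \<inter> complement = {0}"
proof (intro equalityI subsetI)
  fix x assume "x \<in> quasi_Trefftz p \<gamma> c x0 \<inter> complement"
  then have xQ: "x \<in> quasi_Trefftz p \<gamma> c x0" and "x \<in> complement" by simp_all
  then obtain v where x: "x = (\<Sum>k\<le>p. v k)" and v: "\<And>k. k \<le> p \<Longrightarrow> v k \<in> complement_summand k"
    unfolding complement_def by (elim graded_sumE) auto
  have "(\<Sum>k\<le>p. v k) \<in> quasi_Trefftz p \<gamma> c x0 \<longleftrightarrow>
    (\<forall>k\<in>{\<gamma>..p}. frozen_op \<gamma> c x0 (v k) + (\<Sum>j<k. rem_block p \<gamma> c x0 (k - \<gamma>) (v j)) = 0)"
    using v complement_summand_subset by (intro quasi_Trefftz_graded_sum_iff) auto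
  with xQ have eq: "frozen_op \<gamma> c x0 (v k) + (\<Sum>j<k. rem_block p \<gamma> c x0 (k - \<gamma>) (v j)) = 0"
    if "k \<in> {\<gamma>..p}" for k
    using that unfolding x by blast
  have "k \<le> p \<Longrightarrow> v k = 0" for k
  proof (induction k rule: less_induct)
    case (less k)
    show ?case
    proof (cases "k < \<gamma>")
      case True
      with v[OF less.prems] show ?thesis by (simp add: complement_summand_def)
    next
      case False
      with less.prems have k: "k \<in> {\<gamma>..p}" by simp
      have "(\<Sum>j<k. rem_block p \<gamma> c x0 (k - \<gamma>) (v j)) = 0"
        using less by (intro sum.neutral) (simp add: rem_block_zero diff_le_mono)
      with eq[OF k] have "frozen_op \<gamma> c x0 (v k) = 0" by simp
      moreover have "v k \<in> V k" using v[OF less.prems] False by (simp add: complement_summand_def)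
      ultimately show ?thesis using frozen_op_eq_0_imp[OF k] by simp
    qed
  qed
  then show "x \<in> {0}" unfolding x by simp
next
  fix x :: "real ^ 'd \<Rightarrow> 'k" assume "x \<in> {0}"
  then show "x \<in> quasi_Trefftz p \<gamma> c x0 \<inter> complement"
    unfolding complement_def
    using fs.subspace_0[OF subspace_quasi_Trefftz]
      fs.subspace_0[OF subspace_graded_sum[OF subspace_complement_summand]] by simp
qed

text \<open>
  The correction \<open>v\<close> subtracted in step \<open>k\<close> is the element of \<open>V k\<close> on which the constant-coefficient
  operator takes the value \<open>R\<close> plus its value on \<open>u k\<close>, where \<open>R\<close> collects the blocks of the components
  already computed. Hence its value on \<open>u k - v\<close> is \<open>- R\<close>, which is the equation of index \<open>k\<close>.
\<close>

lemma alg_step_solves: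
  assumes u: "\<And>k. k \<le> p \<Longrightarrow> u k \<in> input_summand \<gamma> x0 U k"
  defines "x \<equiv> alg_step p \<gamma> c x0 V u"
  shows "k \<le> p \<Longrightarrow> x k \<in> hom_polys x0 k"
    and "k \<le> p \<Longrightarrow> x k - u k \<in> complement_summand k"
    and "k \<in> {\<gamma>..p} \<Longrightarrow>
      frozen_op \<gamma> c x0 (x k) + (\<Sum>j<k. rem_block p \<gamma> c x0 (k - \<gamma>) (x j)) = 0"
proof -
  have u_hom: "u k \<in> hom_polys x0 k" if "k \<le> p" for k
    using u[OF that] input_summand_subset[OF that] by blast
  have *: "x k \<in> hom_polys x0 k \<and> x k - u k \<in> complement_summand k \<and> (\<gamma> \<le> k \<longrightarrow>
      frozen_op \<gamma> c x0 (x k) + (\<Sum>j<k. rem_block p \<gamma> c x0 (k - \<gamma>) (x j)) = 0)" if "k \<le> p" for k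
    using that
  proof (induction k rule: less_induct)
    case (less k)
    show ?case
    proof (cases "k < \<gamma>")
      case True
      with less.prems show ?thesis
        unfolding x_def by (subst alg_step.simps, simp add: u_hom complement_summand_def)+
    next
      case False
      with less.prems have k: "k \<in> {\<gamma>..p}" by simp
      define R where "R = (\<Sum>j<k. rem_block p \<gamma> c x0 (k - \<gamma>) (x j))"
      define v where "v = the_inv_into (V k) (frozen_op \<gamma> c x0) (R + frozen_op \<gamma> c x0 (u k))"
      have xk: "x k = u k - v"
        using False unfolding x_def v_def R_def by (subst alg_step.simps) simp
      have "R + frozen_op \<gamma> c x0 (u k) \<in> hom_polys x0 (k - \<gamma>)"
        unfolding R_def
      proof (intro fs.subspace_add subspace_hom_polys fs.subspace_sum)
        fix j assume "j \<in> {..<k}"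
        then show "rem_block p \<gamma> c x0 (k - \<gamma>) (x j) \<in> hom_polys x0 (k - \<gamma>)"
          using less by (intro rem_block_in_hom_polys[of _ j] diff_le_mono) auto
      qed (rule frozen_op_hom_polys(1)[OF u_hom[OF less.prems]])
      with frozen_op_bij[OF k] have v: "v \<in> V k" "frozen_op \<gamma> c x0 v = R + frozen_op \<gamma> c x0 (u k)"
        unfolding v_def bij_betw_def by (simp_all add: the_inv_into_into f_the_inv_into_f)
      have v_hom: "v \<in> hom_polys x0 k" by (rule V_in_hom_polys[OF k v(1)])
      have "x k \<in> hom_polys x0 k"
        unfolding xk by (intro fs.subspace_diff subspace_hom_polys u_hom less.prems v_hom)
      moreover have "- v \<in> complement_summand k"
        using False v(1)
        by (intro fs.subspace_neg subspace_complement_summand less.prems) (simp add: complement_summand_def)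
      then have "x k - u k \<in> complement_summand k" unfolding xk by simp
      moreover have "frozen_op \<gamma> c x0 (x k) + R = 0"
        unfolding xk
        by (simp add: frozen_op_diff smooth_hom_polys[OF u_hom[OF less.prems]] smooth_hom_polys[OF v_hom] v(2))
      ultimately show ?thesis unfolding R_def by simp
    qed
  qed
  show "k \<le> p \<Longrightarrow> x k \<in> hom_polys x0 k" "k \<le> p \<Longrightarrow> x k - u k \<in> complement_summand k"
    "k \<in> {\<gamma>..p} \<Longrightarrow>
      frozen_op \<gamma> c x0 (x k) + (\<Sum>j<k. rem_block p \<gamma> c x0 (k - \<gamma>) (x j)) = 0"
    using *[of k] by simp_all
qed

lemma input_components:
  assumes "f \<in> input_space p \<gamma> x0 U"
  defines "u \<equiv> components p (input_summand \<gamma> x0 U) f"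
  shows "k \<le> p \<Longrightarrow> u k \<in> input_summand \<gamma> x0 U k" and "f = (\<Sum>k\<le>p. u k)"
proof -
  obtain g where g: "f = (\<Sum>k\<le>p. g k)" "\<And>k. k \<le> p \<Longrightarrow> g k \<in> input_summand \<gamma> x0 U k"
    using assms(1) unfolding input_space_def by (elim graded_sumE) auto
  have "u = (\<lambda>k. if k \<le> p then g k else 0)"
    unfolding u_def g(1) using input_summand_subset g(2) by (rule components_graded_sum)
  with g show "k \<le> p \<Longrightarrow> u k \<in> input_summand \<gamma> x0 U k" and "f = (\<Sum>k\<le>p. u k)"
    by simp_all
qed

lemma alg_component_in_hom_polys:
  assumes "f \<in> input_space p \<gamma> x0 U" "k \<le> p"
  shows "alg_component p \<gamma> c x0 U V f k \<in> hom_polys x0 k"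
  unfolding alg_component_def
  by (rule alg_step_solves(1)[OF input_components(1)[OF assms(1)] assms(2)])

lemma alg_output_in_quasi_Trefftz:
  assumes "f \<in> input_space p \<gamma> x0 U"
  shows "alg_output p \<gamma> c x0 U V f \<in> quasi_Trefftz p \<gamma> c x0"
  using alg_step_solves(3)[OF input_components(1)[OF assms]] alg_component_in_hom_polys[OF assms]
  unfolding alg_output_def by (subst quasi_Trefftz_graded_sum_iff) (auto simp: alg_component_def)

lemma alg_output_minus_input:
  assumes "f \<in> input_space p \<gamma> x0 U"
  shows "alg_output p \<gamma> c x0 U V f - f \<in> complement"
proof -
  define u where "u = components p (input_summand \<gamma> x0 U) f"
  have "alg_output p \<gamma> c x0 U V f - f = (\<Sum>k\<le>p. alg_step p \<gamma> c x0 V u k) - (\<Sum>k\<le>p. u k)"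
    using input_components(2)[OF assms] unfolding alg_output_def alg_component_def u_def by simp
  also have "\<dots> = (\<Sum>k\<le>p. alg_step p \<gamma> c x0 V u k - u k)"
    by (rule sum_subtractf[symmetric])
  also have "\<dots> \<in> complement"
    unfolding complement_def u_def
    by (intro graded_sumI alg_step_solves(2) input_components(1)[OF assms])
  finally show ?thesis .
qed

text \<open>
  The output is the projection of the input onto the quasi-Trefftz space along the complement.
\<close>

lemma alg_output_projection:
  shows "linear_map_on (input_space p \<gamma> x0 U) (alg_output p \<gamma> c x0 U V)"
    and "inj_on (alg_output p \<gamma> c x0 U V) (input_space p \<gamma> x0 U)"
    and "alg_output p \<gamma> c x0 U V ` input_space p \<gamma> x0 U = quasi_Trefftz p \<gamma> c x0"
    and "is_direct_sum (polys p) (quasi_Trefftz p \<gamma> c x0) complement"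
proof -
  have "quasi_Trefftz p \<gamma> c x0 \<subseteq> polys p"
    by (auto simp: quasi_Trefftz_def)
  note projection = projection_along_complement[OF polys_decomposition subspace_quasi_Trefftz this
      quasi_Trefftz_Int_complement alg_output_in_quasi_Trefftz alg_output_minus_input]
  show "linear_map_on (input_space p \<gamma> x0 U) (alg_output p \<gamma> c x0 U V)"
    by (rule projection(1))
  show "inj_on (alg_output p \<gamma> c x0 U V) (input_space p \<gamma> x0 U)"
    by (rule projection(2))
  show "alg_output p \<gamma> c x0 U V ` input_space p \<gamma> x0 U = quasi_Trefftz p \<gamma> c x0"
    by (rule projection(3))
  show "is_direct_sum (polys p) (quasi_Trefftz p \<gamma> c x0) complement"
    by (rule projection(4))
qed

lemma frozen_op_complement:
  assumes v: "\<And>k. k \<le> p \<Longrightarrow> v k \<in> complement_summand k"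
  shows "frozen_op \<gamma> c x0 (\<Sum>k\<le>p. v k) = (\<Sum>l\<le>p - \<gamma>. frozen_op \<gamma> c x0 (v (l + \<gamma>)))"
proof -
  have "frozen_op \<gamma> c x0 (\<Sum>k\<le>p. v k) = (\<Sum>k\<le>p. frozen_op \<gamma> c x0 (v k))"
    using v complement_summand_subset by (intro frozen_op_sum) (auto dest: smooth_hom_polys)
  also have "\<dots> = (\<Sum>k\<in>{0 + \<gamma>..(p - \<gamma>) + \<gamma>}. frozen_op \<gamma> c x0 (v k))"
  proof (intro sum.mono_neutral_right ballI)
    fix k assume "k \<in> {..p} - {0 + \<gamma>..(p - \<gamma>) + \<gamma>}"
    then have "k \<le> p" "k < \<gamma>" by auto
    then show "frozen_op \<gamma> c x0 (v k) = 0" using v[of k] by (simp add: complement_summand_def)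
  qed (use order_less in auto)
  also have "\<dots> = (\<Sum>l\<le>p - \<gamma>. frozen_op \<gamma> c x0 (v (l + \<gamma>)))"
    by (subst sum.shift_bounds_cl_nat_ivl) (simp add: atLeast0AtMost)
  finally show ?thesis .
qed

lemma frozen_op_complement_summand:
  assumes "v \<in> complement_summand (l + \<gamma>)" "l \<le> p - \<gamma>"
  shows "frozen_op \<gamma> c x0 v \<in> hom_polys x0 l"
proof -
  have "v \<in> hom_polys x0 (l + \<gamma>)"
    using assms order_less by (intro subsetD[OF complement_summand_subset]) simp_all
  from frozen_op_hom_polys(1)[OF this, of \<gamma> c] show ?thesis by simp
qed

text \<open>
  The constant-coefficient operator shifts degrees by \<open>\<gamma>\<close> and is a bijection from \<open>V k\<close> onto the
  homogeneous polynomials of degree \<open>k - \<gamma>\<close>, hence an isomorphism of the graded sums.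
\<close>

lemma dim_complement: "fs.dim complement = fs.dim (polys (p - \<gamma>) :: (real ^ 'd \<Rightarrow> 'k) set)"
proof -
  have sub: "fs.subspace complement"
    unfolding complement_def by (rule subspace_graded_sum[OF subspace_complement_summand])
  have smooth: "smooth f" if "f \<in> complement" for f
    using that complement_summand_subset unfolding complement_def
    by (elim graded_sumE) (auto intro!: smooth_sum dest!: smooth_hom_polys)
  have lin: "linear_map_on complement (frozen_op \<gamma> c x0)"
    using smooth by (simp add: linear_map_on_def frozen_op_add frozen_op_fscale)
  have kernel: "f = 0" if f: "f \<in> complement" "frozen_op \<gamma> c x0 f = 0" for f
  proof -
    obtain v where f_eq: "f = (\<Sum>k\<le>p. v k)" and v: "\<And>k. k \<le> p \<Longrightarrow> v k \<in> complement_summand k"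
      using f(1) unfolding complement_def by (elim graded_sumE) auto
    have hom: "frozen_op \<gamma> c x0 (v (l + \<gamma>)) \<in> hom_polys x0 l" if "l \<le> p - \<gamma>" for l
      using that order_less by (intro frozen_op_complement_summand v) auto
    have frozen_f: "frozen_op \<gamma> c x0 f = (\<Sum>l\<le>p - \<gamma>. frozen_op \<gamma> c x0 (v (l + \<gamma>)))"
      unfolding f_eq by (rule frozen_op_complement[OF v])
    have "v k = 0" if "k \<le> p" for k
    proof (cases "k < \<gamma>")
      case True
      then show ?thesis using v[OF that] by (simp add: complement_summand_def)
    next
      case False
      with that have k: "k \<in> {\<gamma>..p}" by simp
      have "frozen_op \<gamma> c x0 (v k) = taylor_part (k - \<gamma>) x0 (frozen_op \<gamma> c x0 f)"
        unfolding frozen_f using taylor_part_graded_sum[of "p - \<gamma>" "\<lambda>l. frozen_op \<gamma> c x0 (v (l + \<gamma>))" x0 "k - \<gamma>"] hom k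
        by (simp add: diff_le_mono)
      then have "frozen_op \<gamma> c x0 (v k) = 0" by (simp add: f(2))
      moreover have "v k \<in> V k" using v[OF that] False by (simp add: complement_summand_def)
      ultimately show ?thesis using frozen_op_eq_0_imp[OF k] by simp
    qed
    then show ?thesis unfolding f_eq by simp
  qed
  have inj: "inj_on (frozen_op \<gamma> c x0) complement"
  proof (rule inj_onI)
    fix f g assume fg: "f \<in> complement" "g \<in> complement" "frozen_op \<gamma> c x0 f = frozen_op \<gamma> c x0 g"
    then have "frozen_op \<gamma> c x0 (f - g) = 0" by (simp add: frozen_op_diff smooth)
    with fs.subspace_diff[OF sub fg(1,2)] have "f - g = 0" by (rule kernel)
    then show "f = g" by simp
  qed
  have "frozen_op \<gamma> c x0 ` complement = polys (p - \<gamma>)"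
    unfolding polys_eq_graded_sum[of "p - \<gamma>" x0]
  proof (intro equalityI subsetI)
    fix g assume "g \<in> frozen_op \<gamma> c x0 ` complement"
    then obtain v where g: "g = frozen_op \<gamma> c x0 (\<Sum>k\<le>p. v k)"
      and v: "\<And>k. k \<le> p \<Longrightarrow> v k \<in> complement_summand k"
      unfolding complement_def by (auto elim!: graded_sumE)
    have "frozen_op \<gamma> c x0 (v (l + \<gamma>)) \<in> hom_polys x0 l" if "l \<le> p - \<gamma>" for l
      using that order_less by (intro frozen_op_complement_summand v) auto
    then have "(\<Sum>l\<le>p - \<gamma>. frozen_op \<gamma> c x0 (v (l + \<gamma>))) \<in> graded_sum (p - \<gamma>) (hom_polys x0)"
      by (rule graded_sumI)
    moreover have "g = (\<Sum>l\<le>p - \<gamma>. frozen_op \<gamma> c x0 (v (l + \<gamma>)))"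
      unfolding g by (rule frozen_op_complement[OF v])
    ultimately show "g \<in> graded_sum (p - \<gamma>) (hom_polys x0)" by simp
  next
    fix g :: "real ^ 'd \<Rightarrow> 'k" assume "g \<in> graded_sum (p - \<gamma>) (hom_polys x0)"
    then obtain h where g: "g = (\<Sum>l\<le>p - \<gamma>. h l)" and h: "\<And>l. l \<le> p - \<gamma> \<Longrightarrow> h l \<in> hom_polys x0 l"
      by (elim graded_sumE) auto
    have "\<exists>v\<in>V k. frozen_op \<gamma> c x0 v = h (k - \<gamma>)" if "k \<in> {\<gamma>..p}" for k
    proof -
      have "h (k - \<gamma>) \<in> frozen_op \<gamma> c x0 ` V k"
        unfolding bij_betw_imp_surj_on[OF frozen_op_bij[OF that]]
        using that by (intro h) (simp add: diff_le_mono)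
      then show ?thesis by auto
    qed
    then obtain w where w: "\<And>k. k \<in> {\<gamma>..p} \<Longrightarrow> w k \<in> V k \<and> frozen_op \<gamma> c x0 (w k) = h (k - \<gamma>)"
      by metis
    define v where "v k = (if k < \<gamma> then 0 else w k)" for k
    have v: "v k \<in> complement_summand k" if "k \<le> p" for k
      using that w[of k] by (simp add: v_def complement_summand_def)
    have "frozen_op \<gamma> c x0 (\<Sum>k\<le>p. v k) = (\<Sum>l\<le>p - \<gamma>. frozen_op \<gamma> c x0 (v (l + \<gamma>)))"
      by (rule frozen_op_complement[OF v])
    also have "\<dots> = g"
      unfolding g using w order_less by (intro sum.cong refl) (simp add: v_def)
    finally have "frozen_op \<gamma> c x0 (\<Sum>k\<le>p. v k) = g" .
    moreover have "(\<Sum>k\<le>p. v k) \<in> complement"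
      unfolding complement_def using v by (rule graded_sumI)
    ultimately show "g \<in> frozen_op \<gamma> c x0 ` complement" by blast
  qed
  with dim_image_eq[OF sub lin inj] show ?thesis by simp
qed

lemma dim_quasi_Trefftz:
  "fs.dim (polys p :: (real ^ 'd \<Rightarrow> 'k) set) =
    fs.dim (quasi_Trefftz p \<gamma> c x0) + fs.dim (polys (p - \<gamma>) :: (real ^ 'd \<Rightarrow> 'k) set)"
proof -
  have "finite (\<Union>m\<le>p. shifted_monom 0 ` multi_indices m :: (real ^ 'd \<Rightarrow> 'k) set)"
    by (simp add: finite_multi_indices)
  from dim_direct_sum[OF alg_output_projection(4) this] show ?thesis
    unfolding dim_complement by (simp add: polys_def)
qed

end

section \<open>Outputs, bases and dimension of the quasi-Trefftz space\<close>

theorem theorem6: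
  fixes \<gamma> p :: nat
    and x0 :: "real ^ 'd"
    and c :: "('d \<Rightarrow> nat) \<Rightarrow> real ^ 'd \<Rightarrow> 'k::real_normed_field"
    and U V :: "nat \<Rightarrow> (real ^ 'd \<Rightarrow> 'k) set"
    and I :: "'i set"
    and Y :: "'i \<Rightarrow> real ^ 'd \<Rightarrow> 'k"
  assumes "\<gamma> \<ge> 1" and "p > \<gamma>"
    and "\<And>m j. m \<le> \<gamma> \<Longrightarrow> j \<in> multi_indices m \<Longrightarrow> cont_diff_near (p - \<gamma>) x0 (c j)"
    and "\<And>n. n \<in> {\<gamma>..p} \<Longrightarrow> is_direct_sum (hom_polys x0 n) (U n) (V n)"
    and "\<And>n. n \<in> {\<gamma>..p} \<Longrightarrow> bij_betw (frozen_op \<gamma> c x0) (V n) (hom_polys x0 (n - \<gamma>))"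
  shows
    "(\<forall>n. frozen_op \<gamma> c x0 ` hom_polys x0 (n + \<gamma>) \<subseteq> hom_polys x0 n) \<and>
     (\<forall>n\<le>p. \<forall>f\<in>hom_polys x0 n.
        (\<forall>l\<le>p - \<gamma>. rem_block p \<gamma> c x0 l f \<in> hom_polys x0 l) \<and>
        rem_op p \<gamma> c x0 f = (\<Sum>l\<le>p - \<gamma>. rem_block p \<gamma> c x0 l f) \<and>
        (n \<ge> \<gamma> \<longrightarrow> (\<forall>l\<le>n - \<gamma>. rem_block p \<gamma> c x0 l f = 0))) \<and>
     (\<forall>f\<in>input_space p \<gamma> x0 U. \<forall>n\<le>p. alg_component p \<gamma> c x0 U V f n \<in> hom_polys x0 n) \<and>
     alg_output p \<gamma> c x0 U V ` input_space p \<gamma> x0 U = quasi_Trefftz p \<gamma> c x0 \<and>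
     (is_basis I Y (input_space p \<gamma> x0 U) \<longrightarrow>
        is_basis I (\<lambda>i. alg_output p \<gamma> c x0 U V (Y i)) (quasi_Trefftz p \<gamma> c x0)) \<and>
     int (fs.dim (quasi_Trefftz p \<gamma> c x0)) =
       int (fs.dim (polys p :: (real ^ 'd \<Rightarrow> 'k) set)) -
       int (fs.dim (polys (p - \<gamma>) :: (real ^ 'd \<Rightarrow> 'k) set))"
proof -
  interpret quasi_Trefftz_algorithm \<gamma> p x0 c U V
    by unfold_locales (use assms in auto)
  have input: "fs.subspace (input_space p \<gamma> x0 U)"
    using polys_decomposition by (simp add: is_direct_sum_def)
  have range: "frozen_op \<gamma> c x0 ` hom_polys x0 (n + \<gamma>) \<subseteq> hom_polys x0 n" for n
    using frozen_op_hom_polys(1)[of _ x0 "n + \<gamma>" \<gamma> c] by auto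
  have blocks: "(\<forall>l\<le>p - \<gamma>. rem_block p \<gamma> c x0 l f \<in> hom_polys x0 l) \<and>
      rem_op p \<gamma> c x0 f = (\<Sum>l\<le>p - \<gamma>. rem_block p \<gamma> c x0 l f) \<and>
      (n \<ge> \<gamma> \<longrightarrow> (\<forall>l\<le>n - \<gamma>. rem_block p \<gamma> c x0 l f = 0))"
    if "n \<le> p" "f \<in> hom_polys x0 n" for n f
    using rem_block_in_hom_polys[OF that(2,1)] rem_op_eq_sum_rem_block[OF that(2,1)]
      rem_block_eq_0[OF that(2,1)] by simp
  have basis: "is_basis I (\<lambda>i. alg_output p \<gamma> c x0 U V (Y i)) (quasi_Trefftz p \<gamma> c x0)"
    if "is_basis I Y (input_space p \<gamma> x0 U)"
    using is_basis_image[OF input alg_output_projection(1,2) that] unfolding alg_output_projection(3) .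
  show ?thesis
    using range blocks alg_component_in_hom_polys alg_output_projection(3) basis dim_quasi_Trefftz by simp
qed

end
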